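(* Let $(J,R,Q,B)\in\Sigma_{n,m}$ and $S=0_{m\times m}$. Then $$\operatorname{im}B\cap\ker RQ=\{0\}=\ker B$$ holds if and only if the pencil $s\mathcal{E}-\mathcal{A}_S$ is regular with Kronecker index three.
   Context: $\mathbb{K}\in\{\mathbb{R},\mathbb{C}\}$, $n,m$ are positive integers, $A^H$ is the conjugate transpose, and $A\ge0$ means $x^HAx\ge0$ for all $x$. $\Sigma_{n,m}$ is the set of all $(J,R,Q,B)\in(\mathbb{K}^{n\times n})^3\times\mathbb{K}^{n\times m}$ with $J=-J^H$, $R=R^H\ge0$, $Q=Q^H\ge0$. The optimality pencil $s\mathcal{E}-\mathcal{A}_S$ has coefficients $$\mathcal{E}=\begin{bmatrix}0_{n\times n}&I_n&0_{n\times m}\\-I_n&0_{n\times n}&0_{n\times m}\\0_{m\times n}&0_{m\times n}&0_{m\times m}\end{bmatrix},\qquad \mathcal{A}_S=\begin{bmatrix}0_{n\times n}&(J-R)Q&B\\((J-R)Q)^H&QRQ&0_{n\times m}\\ B^H&0_{m\times n}&S\end{bmatrix}.$$ It is called regular if $\det(s\mathcal{E}-\mathcal{A}_S)$ is not the zero polynomial in $s$. The Kronecker index of the pencil is the size of the largest block associated with the eigenvalue $\infty$ in its Kronecker canonical form. (For a regular pencil $sE-A$, there are invertible $P,T$ with $P(sE-A)T=\operatorname{diag}(sI-A_1,\,sN-I)$, $N$ nilpotent, and this is the nilpotency index of $N$.) *)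

theory Defs
  imports
    "Jordan_Normal_Form.Determinant"
    "Jordan_Normal_Form.Matrix_Kernel"
    "Jordan_Normal_Form.Schur_Decomposition"
begin

(* For real and complex scalars, 0 \<le> z on the type 'a means that z is real and nonnegative:
   this is the usual order on real, and the order of Complex_Order on complex.
   conjugate x \<bullet> (A *\<^sub>v x) is x^H A x. *)
definition psd_mat :: "nat \<Rightarrow> 'a::conjugatable_ordered_field mat \<Rightarrow> bool" where
  "psd_mat n A \<longleftrightarrow> (\<forall>x \<in> carrier_vec n. 0 \<le> conjugate x \<bullet> (A *\<^sub>v x))"

definition Sigma_sys ::
  "nat \<Rightarrow> nat \<Rightarrow> ('a::conjugatable_ordered_field mat \<times> 'a mat \<times> 'a mat \<times> 'a mat) set" where
  "Sigma_sys n m = {(J, R, Q, B).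
     J \<in> carrier_mat n n \<and> R \<in> carrier_mat n n \<and> Q \<in> carrier_mat n n \<and> B \<in> carrier_mat n m \<and>
     J = - mat_adjoint J \<and>
     R = mat_adjoint R \<and> psd_mat n R \<and>
     Q = mat_adjoint Q \<and> psd_mat n Q}"

definition im_mat :: "'a::comm_ring_1 mat \<Rightarrow> 'a vec set" where
  "im_mat A = {A *\<^sub>v v | v. v \<in> carrier_vec (dim_col A)}"

definition const_poly_mat :: "'a::zero mat \<Rightarrow> 'a poly mat" where
  "const_poly_mat A = map_mat (\<lambda>a. [:a:]) A"

(* The pencil s E - A, as a matrix over the polynomials in the indeterminate s = [:0, 1:]. *)
definition pencil :: "'a::comm_ring_1 mat \<Rightarrow> 'a mat \<Rightarrow> 'a poly mat" where
  "pencil E A = [:0, 1:] \<cdot>\<^sub>m const_poly_mat E - const_poly_mat A"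

definition regular_pencil :: "'a::comm_ring_1 mat \<Rightarrow> 'a mat \<Rightarrow> bool" where
  "regular_pencil E A \<longleftrightarrow> square_mat (pencil E A) \<and> det (pencil E A) \<noteq> 0"

definition nilpotent_mat :: "'a::comm_ring_1 mat \<Rightarrow> bool" where
  "nilpotent_mat N \<longleftrightarrow> square_mat N \<and> (\<exists>k. N ^\<^sub>m k = 0\<^sub>m (dim_row N) (dim_row N))"

definition nilpotency_index :: "'a::comm_ring_1 mat \<Rightarrow> nat" where
  "nilpotency_index N = (LEAST k. N ^\<^sub>m k = 0\<^sub>m (dim_row N) (dim_row N))"

(* P (s E - A) T = diag (s I - A1, s N - I) with P, T constant invertible, N nilpotent.
   Either diagonal block may be empty (size 0). *)
definition weierstrass_form ::
  "'a::field mat \<Rightarrow> 'a mat \<Rightarrow> 'a mat \<Rightarrow> 'a mat \<Rightarrow> 'a mat \<Rightarrow> 'a mat \<Rightarrow> bool" where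
  "weierstrass_form E A P T A1 N \<longleftrightarrow>
     (let d = dim_row E; p = dim_row A1; q = dim_row N in
      {E, A, P, T} \<subseteq> carrier_mat d d \<and> A1 \<in> carrier_mat p p \<and> N \<in> carrier_mat q q \<and>
      p + q = d \<and> invertible_mat P \<and> invertible_mat T \<and> nilpotent_mat N \<and>
      const_poly_mat P * pencil E A * const_poly_mat T =
        four_block_mat (pencil (1\<^sub>m p) A1) (0\<^sub>m p q) (0\<^sub>m q p) (pencil N (1\<^sub>m q)))"

(* For a regular pencil, the Kronecker index (the size of the largest block at infinity in the
   Kronecker canonical form) is the nilpotency index of N in P (s E - A) T =
   diag (s I - A1, s N - I).  Such a decomposition exists exactly for regular pencils, and N is
   unique up to similarity, so for a regular pencil the relation below determines the index
   uniquely.  The index is 0 if N is empty. *)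
definition has_kronecker_index :: "'a::field mat \<Rightarrow> 'a mat \<Rightarrow> nat \<Rightarrow> bool" where
  "has_kronecker_index E A \<nu> \<longleftrightarrow>
     (\<exists>P T A1 N. weierstrass_form E A P T A1 N \<and> nilpotency_index N = \<nu>)"

(* 3 x 3 block matrix, rows listed from top to bottom. *)
definition nine_block_mat ::
  "'a::zero mat \<Rightarrow> 'a mat \<Rightarrow> 'a mat \<Rightarrow>
   'a mat \<Rightarrow> 'a mat \<Rightarrow> 'a mat \<Rightarrow>
   'a mat \<Rightarrow> 'a mat \<Rightarrow> 'a mat \<Rightarrow> 'a mat" where
  "nine_block_mat A11 A12 A13
                  A21 A22 A23
                  A31 A32 A33 =
     four_block_mat
       (four_block_mat A11 A12 A21 A22)
       (A13 @\<^sub>r A23)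
       (A31\<^sup>T @\<^sub>r A32\<^sup>T)\<^sup>T
       A33"

definition opt_E :: "nat \<Rightarrow> nat \<Rightarrow> 'a::comm_ring_1 mat" where
  "opt_E n m = nine_block_mat
     (0\<^sub>m n n)   (1\<^sub>m n)   (0\<^sub>m n m)
     (- 1\<^sub>m n)   (0\<^sub>m n n) (0\<^sub>m n m)
     (0\<^sub>m m n)   (0\<^sub>m m n) (0\<^sub>m m m)"

definition opt_A ::
  "nat \<Rightarrow> nat \<Rightarrow> 'a::conjugatable_field mat \<Rightarrow> 'a mat \<Rightarrow> 'a mat \<Rightarrow> 'a mat \<Rightarrow> 'a mat \<Rightarrow> 'a mat" where
  "opt_A n m J R Q B S = nine_block_mat
     (0\<^sub>m n n)                   ((J - R) * Q)  B
     (mat_adjoint ((J - R) * Q)) (Q * R * Q)    (0\<^sub>m n m)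
     (mat_adjoint B)             (0\<^sub>m m n)      S"

end

theory Submission
  imports Defs
begin

text \<open>
The Kronecker index is read off from chains at infinity, that is, sequences of vectors with
\<open>z 0 \<noteq> 0\<close>, \<open>E (z 0) = 0\<close> and \<open>E (z (i + 1)) = A (z i)\<close>.  In Weierstrass coordinates such a sequence lives on
the nilpotent block \<open>N\<close>, where \<open>N\<close> maps each vector to its predecessor; so chains with \<open>k\<close> steps exist
if and only if \<open>N\<^sup>k \<noteq> 0\<close> (\<open>weierstrass_nilpotent_pow_iff_chain\<close>).  A singular pencil has chains with any
number of steps, given by the coefficients of a polynomial kernel vector
(\<open>singular_pencil_has_chain\<close>), and a regular pencil has a Weierstrass form
(\<open>weierstrass_blocks_exist\<close>).  Hence a square pencil is regular with index \<open>k + 1\<close> if and only if chains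
with \<open>k\<close> steps exist and chains with \<open>k + 1\<close> steps do not (\<open>kronecker_index_iff_chains\<close>).

For the optimality pencil, put \<open>F = (J - R) Q\<close> and \<open>W = Q R Q\<close>.  A chain starts with a vector \<open>(0, 0, v)\<close>,
\<open>v \<noteq> 0\<close>, and continues as \<open>(0, B v, \<dots>)\<close>, \<open>(- W B v, F B v + \<dots>, \<dots>)\<close>.  Two steps are always possible; a third one
is possible if and only if \<open>B\<^sup>H W B v = 0\<close>, because of the last block row.  So the pencil is
regular with index three if and only if \<open>B\<^sup>H W B v = 0\<close> forces \<open>v = 0\<close>.  As \<open>R\<close> is positive semidefinite,
\<open>B\<^sup>H W B v = 0\<close> means \<open>R Q B v = 0\<close> (\<open>gram_kernel_iff\<close>), and the triviality of the kernel of \<open>R Q B\<close> is the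
stated condition on \<open>im B\<close>, \<open>ker R Q\<close> and \<open>ker B\<close>.
\<close>

section \<open>Invertible matrices\<close>

lemma invertible_mat_inverse:
  assumes "invertible_mat A" and A: "A \<in> carrier_mat d d"
  obtains B where "B \<in> carrier_mat d d" "A * B = 1\<^sub>m d" "B * A = 1\<^sub>m d"
proof -
  from assms obtain B where AB: "A * B = 1\<^sub>m (dim_row A)" and BA: "B * A = 1\<^sub>m (dim_row B)"
    unfolding invertible_mat_def inverts_mat_def by auto
  from AB A have "dim_col (A * B) = d" by simp
  moreover from BA A have "dim_row B = d"
    by (metis carrier_matD(2) index_mult_mat(3) index_one_mat(3))
  ultimately have "B \<in> carrier_mat d d" by auto
  with that AB BA A show ?thesis by auto
qed

lemma invertible_matI:
  assumes "A \<in> carrier_mat d d" "B \<in> carrier_mat d d" "A * B = 1\<^sub>m d" "B * A = 1\<^sub>m d"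
  shows "invertible_mat A"
  using assms unfolding invertible_mat_def inverts_mat_def by (auto intro!: exI[of _ B])

lemma invertible_mat_det:
  fixes A :: "'a::field mat"
  assumes A: "A \<in> carrier_mat d d" and "det A \<noteq> 0"
  shows "invertible_mat A"
proof (rule invertible_matI[OF A])
  let ?B = "inverse (det A) \<cdot>\<^sub>m adj_mat A"
  note adj = adj_mat[OF A]
  show "?B \<in> carrier_mat d d" using adj by auto
  have cancel: "inverse (det A) \<cdot>\<^sub>m (det A \<cdot>\<^sub>m 1\<^sub>m d) = 1\<^sub>m d"
    using assms(2) by (intro eq_matI) auto
  show "A * ?B = 1\<^sub>m d" "?B * A = 1\<^sub>m d"
    using mult_smult_distrib[OF A adj(1)] mult_smult_assoc_mat[OF adj(1) A] adj(2,3) cancel by auto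
qed

lemma invertible_mat_times:
  fixes A :: "'a::field mat"
  assumes "invertible_mat A" "invertible_mat B" and A: "A \<in> carrier_mat d d" and B: "B \<in> carrier_mat d d"
  shows "invertible_mat (A * B)"
proof -
  obtain A' where A': "A' \<in> carrier_mat d d" "A * A' = 1\<^sub>m d" "A' * A = 1\<^sub>m d"
    by (rule invertible_mat_inverse[OF assms(1) A])
  obtain B' where B': "B' \<in> carrier_mat d d" "B * B' = 1\<^sub>m d" "B' * B = 1\<^sub>m d"
    by (rule invertible_mat_inverse[OF assms(2) B])
  have *: "(X * Y) * (Y' * X') = 1\<^sub>m d"
    if "X \<in> carrier_mat d d" "Y \<in> carrier_mat d d" "X' \<in> carrier_mat d d" "Y' \<in> carrier_mat d d"
      "X * X' = 1\<^sub>m d" "Y * Y' = 1\<^sub>m d" for X Y X' Y' :: "'a mat"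
  proof -
    have "(X * Y) * (Y' * X') = X * (Y * (Y' * X'))" using that by (intro assoc_mult_mat) auto
    also have "Y * (Y' * X') = (Y * Y') * X'" using that by (intro assoc_mult_mat[symmetric]) auto
    finally show ?thesis using that by simp
  qed
  show ?thesis using *[of A B A' B'] *[of B' A' B A] A B A' B'
    by (intro invertible_matI[of _ d "B' * A'"]) auto
qed

text \<open>
The standard basis with one vector exchanged: if \<open>v\<close> has a nonzero entry at \<open>i\<close>, then \<open>v\<close> together with
all unit vectors except the \<open>i\<close>-th is a basis.  The function \<open>f\<close> below moves the unit vector that
would stand in the last column to column \<open>i\<close>.
\<close>
lemma mat_with_last_column:
  fixes v :: "'a::field vec"
  assumes v: "v \<in> carrier_vec (Suc d)" "v \<noteq> 0\<^sub>v (Suc d)"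
  obtains T where "T \<in> carrier_mat (Suc d) (Suc d)" "invertible_mat T" "col T d = v"
proof -
  from v obtain i where i: "i < Suc d" "v $ i \<noteq> 0"
    by (metis carrier_vecD eq_vecI index_zero_vec(1) index_zero_vec(2))
  define f where "f b = (if b = i then d else b)" for b
  define T where "T = mat (Suc d) (Suc d)
    (\<lambda>(a, b). if b = d then v $ a else if a = f b then 1 else 0)"
  have T: "T \<in> carrier_mat (Suc d) (Suc d)" by (simp add: T_def)
  have "x = 0\<^sub>v (Suc d)" if x: "x \<in> carrier_vec (Suc d)" and Tx: "T *\<^sub>v x = 0\<^sub>v (Suc d)" for x
  proof -
    have row: "(\<Sum>b<d. (if a = f b then x $ b else 0)) + v $ a * x $ d = 0" if a: "a < Suc d" for a
    proof -
      have "(T *\<^sub>v x) $ a = (\<Sum>b<Suc d. T $$ (a, b) * x $ b)"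
        using a T x by (auto simp: scalar_prod_def lessThan_atLeast0)
      also have "\<dots> = (\<Sum>b<d. (if a = f b then x $ b else 0)) + v $ a * x $ d"
        using a by (auto simp: T_def intro!: sum.cong)
      finally show ?thesis using Tx a by simp
    qed
    have "i \<noteq> f b" if "b < d" for b using that by (auto simp: f_def)
    then have d0: "x $ d = 0" using row[OF i(1)] i(2) by auto
    have "x $ b = 0" if b: "b < d" for b
    proof -
      have "(\<Sum>b'<d. (if f b = f b' then x $ b' else 0)) = (\<Sum>b'<d. (if b = b' then x $ b' else 0))"
        using b by (intro sum.cong) (auto simp: f_def split: if_splits)
      also have "\<dots> = x $ b" using b by simp
      finally show ?thesis using row[of "f b"] b d0 by (auto simp: f_def)
    qed
    with d0 x show ?thesis by (intro eq_vecI) (auto simp: less_Suc_eq)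
  qed
  then have "det T \<noteq> 0" using det_0_iff_vec_prod_zero[OF T] by auto
  then have "invertible_mat T" by (rule invertible_mat_det[OF T])
  moreover have "col T d = v" using v by (intro eq_vecI) (auto simp: T_def)
  ultimately show ?thesis using that T by blast
qed

lemma mult_mat_zero_vec:
  assumes "X \<in> carrier_mat a b"
  shows "X *\<^sub>v 0\<^sub>v b = (0\<^sub>v a :: 'a::semiring_0 vec)"
  using assms by (intro eq_vecI) (auto simp: scalar_prod_def)

section \<open>Matrix pencils and strict equivalence\<close>

lemma const_poly_mat_mult:
  fixes A B :: "'a::comm_ring_1 mat"
  assumes "A \<in> carrier_mat a b" "B \<in> carrier_mat b c"
  shows "const_poly_mat (A * B) = const_poly_mat A * const_poly_mat B"
proof (rule eq_matI)
  have sum_const: "[:sum f S:] = (\<Sum>i\<in>S. [:f i:])" for f :: "nat \<Rightarrow> 'a" and S :: "nat set"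
    by (induction S rule: infinite_finite_induct) (simp_all, metis add_pCons add_0)
  fix i j assume "i < dim_row (const_poly_mat A * const_poly_mat B)"
    "j < dim_col (const_poly_mat A * const_poly_mat B)"
  then show "const_poly_mat (A * B) $$ (i, j) = (const_poly_mat A * const_poly_mat B) $$ (i, j)"
    using assms by (auto simp: const_poly_mat_def scalar_prod_def sum_const mult.commute)
qed (use assms in \<open>auto simp: const_poly_mat_def\<close>)

lemma const_poly_mat_carrier [simp]:
  "const_poly_mat A \<in> carrier_mat a b \<longleftrightarrow> A \<in> carrier_mat a b"
  by (auto simp: const_poly_mat_def)

lemma const_poly_mat_one [simp]: "const_poly_mat (1\<^sub>m d :: 'a::comm_ring_1 mat) = 1\<^sub>m d"
  by (rule eq_matI) (auto simp: const_poly_mat_def one_pCons)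

lemma pencil_carrier [simp]:
  "A \<in> carrier_mat a b \<Longrightarrow> pencil E A \<in> carrier_mat a b"
  by (auto simp: pencil_def const_poly_mat_def)

lemma pencil_index:
  assumes "E \<in> carrier_mat a b" "A \<in> carrier_mat a b" "i < a" "j < b"
  shows "pencil E A $$ (i, j) = [:- A $$ (i, j), E $$ (i, j):]"
  using assms by (auto simp: pencil_def const_poly_mat_def)

lemma pencil_mult:
  fixes E :: "'a::comm_ring_1 mat"
  assumes c: "P \<in> carrier_mat d d" "T \<in> carrier_mat d d" "E \<in> carrier_mat d d" "A \<in> carrier_mat d d"
  shows "const_poly_mat P * pencil E A * const_poly_mat T = pencil (P * E * T) (P * A * T)"
proof -
  let ?c = const_poly_mat
  have "?c P * pencil E A = [:0, 1:] \<cdot>\<^sub>m (?c P * ?c E) - ?c P * ?c A"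
    using c unfolding pencil_def
    by (subst mult_minus_distrib_mat[of _ d d _ d]) (auto simp: mult_smult_distrib[of _ d d _ d])
  also have "\<dots> * ?c T = [:0, 1:] \<cdot>\<^sub>m (?c P * ?c E * ?c T) - ?c P * ?c A * ?c T"
    using c by (subst minus_mult_distrib_mat[of _ d d _ _ d])
      (auto intro!: mult_carrier_mat simp: mult_smult_assoc_mat[of _ d d _ d])
  finally show ?thesis
    using c by (simp add: pencil_def const_poly_mat_mult[of _ d d _ d])
qed

lemma pencil_four_block:
  assumes "E1 \<in> carrier_mat a c" "A1 \<in> carrier_mat a c" "E2 \<in> carrier_mat a e" "A2 \<in> carrier_mat a e"
    "E3 \<in> carrier_mat b c" "A3 \<in> carrier_mat b c" "E4 \<in> carrier_mat b e" "A4 \<in> carrier_mat b e"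
  shows "pencil (four_block_mat E1 E2 E3 E4) (four_block_mat A1 A2 A3 A4) =
    four_block_mat (pencil E1 A1) (pencil E2 A2) (pencil E3 A3) (pencil E4 A4)"
  by (rule eq_matI) (use assms in \<open>auto simp: pencil_def const_poly_mat_def\<close>)

lemma pencil_zero [simp]: "pencil (0\<^sub>m a b) (0\<^sub>m a b) = 0\<^sub>m a b"
  by (rule eq_matI) (auto simp: pencil_def const_poly_mat_def)

lemma det_const_poly_mat_nonzero:
  fixes P :: "'a::field mat"
  assumes "invertible_mat P" "P \<in> carrier_mat d d"
  shows "det (const_poly_mat P) \<noteq> 0"
proof -
  obtain P' where P': "P' \<in> carrier_mat d d" "P * P' = 1\<^sub>m d"
    by (rule invertible_mat_inverse[OF assms])
  have "det (const_poly_mat P) * det (const_poly_mat P') = det (const_poly_mat P * const_poly_mat P')"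
    using assms P' by (intro det_mult[symmetric]) auto
  also have "const_poly_mat P * const_poly_mat P' = 1\<^sub>m d"
    using const_poly_mat_mult[OF assms(2) P'(1)] P'(2) by simp
  finally show ?thesis by auto
qed

text \<open>
Comparing coefficients of powers of \<open>s\<close> turns a polynomial kernel vector of the pencil into a sequence
of constant vectors linked by \<open>E\<close> and \<open>A\<close>; this is where chains at infinity come from.
\<close>
lemma coeff_pencil_mult_vec:
  fixes E :: "'a::field mat"
  assumes E: "E \<in> carrier_mat d d" and A: "A \<in> carrier_mat d d" and z: "z \<in> carrier_vec d" and i: "i < d"
  shows "coeff ((pencil E A *\<^sub>v z) $ i) 0 = - (A *\<^sub>v map_vec (\<lambda>p. coeff p 0) z) $ i"
    and "coeff ((pencil E A *\<^sub>v z) $ i) (Suc j) =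
      (E *\<^sub>v map_vec (\<lambda>p. coeff p j) z) $ i - (A *\<^sub>v map_vec (\<lambda>p. coeff p (Suc j)) z) $ i"
proof -
  have entry: "(pencil E A *\<^sub>v z) $ i = (\<Sum>b = 0..<d. [:- A $$ (i, b), E $$ (i, b):] * z $ b)"
    using pencil_carrier[OF A, of E] z i pencil_index[OF E A i] by (auto simp: scalar_prod_def)
  show "coeff ((pencil E A *\<^sub>v z) $ i) 0 = - (A *\<^sub>v map_vec (\<lambda>p. coeff p 0) z) $ i"
    unfolding entry using A z i by (auto simp: scalar_prod_def coeff_sum sum_negf)
  show "coeff ((pencil E A *\<^sub>v z) $ i) (Suc j) =
      (E *\<^sub>v map_vec (\<lambda>p. coeff p j) z) $ i - (A *\<^sub>v map_vec (\<lambda>p. coeff p (Suc j)) z) $ i"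
    unfolding entry using E A z i
    by (auto simp: scalar_prod_def coeff_sum sum_subtractf[symmetric] mult_pCons_left intro!: sum.cong)
qed

lemma det_pencil_common_kernel:
  fixes E :: "'a::field mat"
  assumes E: "E \<in> carrier_mat d d" and A: "A \<in> carrier_mat d d"
    and v: "v \<in> carrier_vec d" "v \<noteq> 0\<^sub>v d" "E *\<^sub>v v = 0\<^sub>v d" "A *\<^sub>v v = 0\<^sub>v d"
  shows "det (pencil E A) = 0"
proof -
  let ?z = "map_vec (\<lambda>a. [:a:]) v"
  have z: "?z \<in> carrier_vec d" using v by auto
  have c0: "map_vec (\<lambda>p. coeff p 0) ?z = v" and cS: "map_vec (\<lambda>p. coeff p (Suc j)) ?z = 0\<^sub>v d" for j
    using v by (auto intro!: eq_vecI)
  have A0: "A *\<^sub>v 0\<^sub>v d = 0\<^sub>v d" "E *\<^sub>v 0\<^sub>v d = 0\<^sub>v d"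
    by (rule mult_mat_zero_vec[OF A], rule mult_mat_zero_vec[OF E])
  have "pencil E A *\<^sub>v ?z = 0\<^sub>v d"
  proof (rule eq_vecI)
    fix i assume "i < dim_vec (0\<^sub>v d :: 'a poly vec)"
    then have i: "i < d" by simp
    have "coeff ((pencil E A *\<^sub>v ?z) $ i) j = 0" for j
    proof (cases j)
      case 0
      then show ?thesis using coeff_pencil_mult_vec(1)[OF E A z i] v i by (simp only: c0) simp
    next
      case (Suc l)
      then show ?thesis using coeff_pencil_mult_vec(2)[OF E A z i, of l] v i A0
        by (cases l) (simp_all only: c0 cS, simp_all)
    qed
    then show "(pencil E A *\<^sub>v ?z) $ i = 0\<^sub>v d $ i" using i by (auto intro: poly_eqI)
  qed (use pencil_carrier[OF A, of E] in auto)
  moreover have "?z \<noteq> 0\<^sub>v d"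
  proof
    assume "?z = 0\<^sub>v d"
    then have "map_vec (\<lambda>p. coeff p 0) ?z = 0\<^sub>v d" by (auto intro!: eq_vecI)
    with v c0 show False by simp
  qed
  ultimately show ?thesis using det_0_iff_vec_prod_zero[OF pencil_carrier[OF A, of E]] z by blast
qed

text \<open>
The equivalence under which the Weierstrass form is a normal form.  Keeping \<open>E\<close> and \<open>A\<close> apart as
constant matrices avoids polynomial matrices in the block manipulations that follow.
\<close>
definition strictly_equivalent :: "nat \<Rightarrow> 'a::field mat \<Rightarrow> 'a mat \<Rightarrow> 'a mat \<Rightarrow> 'a mat \<Rightarrow> bool" where
  "strictly_equivalent d E A E' A' \<longleftrightarrow>
     (\<exists>P \<in> carrier_mat d d. \<exists>T \<in> carrier_mat d d. invertible_mat P \<and> invertible_mat T \<and>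
        P * E * T = E' \<and> P * A * T = A')"

lemma strictly_equivalent_trans:
  fixes E :: "'a::field mat"
  assumes c: "E \<in> carrier_mat d d" "A \<in> carrier_mat d d"
    and 1: "strictly_equivalent d E A E' A'" and 2: "strictly_equivalent d E' A' E'' A''"
  shows "strictly_equivalent d E A E'' A''"
proof -
  from 1 obtain P T where PT: "P \<in> carrier_mat d d" "T \<in> carrier_mat d d" "invertible_mat P"
    "invertible_mat T" "P * E * T = E'" "P * A * T = A'" by (auto simp: strictly_equivalent_def)
  from 2 obtain P' T' where PT': "P' \<in> carrier_mat d d" "T' \<in> carrier_mat d d" "invertible_mat P'"
    "invertible_mat T'" "P' * E' * T' = E''" "P' * A' * T' = A''"
    by (auto simp: strictly_equivalent_def)
  have eq: "(P' * P) * X * (T * T') = P' * (P * X * T) * T'" if X: "X \<in> carrier_mat d d" for X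
  proof -
    have "(P' * P) * X * (T * T') = (P' * P * X * T) * T'"
      using X PT PT' by (intro assoc_mult_mat[symmetric, of _ d d _ d _ d]) auto
    also have "P' * P * X * T = P' * (P * X) * T"
      using X PT PT' by (simp add: assoc_mult_mat[of P' d d P d X d])
    also have "\<dots> = P' * (P * X * T)"
      using X PT PT' by (intro assoc_mult_mat[of _ d d _ d _ d]) auto
    finally show ?thesis .
  qed
  show ?thesis unfolding strictly_equivalent_def
    by (rule bexI[of _ "P' * P"], rule bexI[of _ "T * T'"])
      (use PT PT' c eq in \<open>auto intro!: invertible_mat_times\<close>)
qed

lemma strictly_equivalent_det_pencil:
  fixes E :: "'a::field mat"
  assumes c: "E \<in> carrier_mat d d" "A \<in> carrier_mat d d"
    and eq: "strictly_equivalent d E A E' A'" and "det (pencil E A) \<noteq> 0"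
  shows "det (pencil E' A') \<noteq> 0"
proof -
  from eq obtain P T where PT: "P \<in> carrier_mat d d" "T \<in> carrier_mat d d" "invertible_mat P"
    "invertible_mat T" "P * E * T = E'" "P * A * T = A'" by (auto simp: strictly_equivalent_def)
  have "det (const_poly_mat P * pencil E A * const_poly_mat T)
      = det (const_poly_mat P) * det (pencil E A) * det (const_poly_mat T)"
    using PT c det_mult[of "const_poly_mat P * pencil E A" d "const_poly_mat T"]
      det_mult[of "const_poly_mat P" d "pencil E A"] by simp
  then show ?thesis
    using pencil_mult[OF PT(1,2) c] det_const_poly_mat_nonzero PT assms(4) by auto
qed

section \<open>Existence of the Weierstrass form\<close>

lemma triangular_block_invertible:
  fixes P :: "'a::field mat"
  assumes "invertible_mat P" "P \<in> carrier_mat d d" "x \<in> carrier_mat 1 d"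
  shows "invertible_mat (four_block_mat P (0\<^sub>m d 1) x (1\<^sub>m 1))"
proof (rule invertible_mat_det)
  obtain P' where P': "P' \<in> carrier_mat d d" "P * P' = 1\<^sub>m d"
    by (rule invertible_mat_inverse[OF assms(1,2)])
  then have "det P * det P' = 1" using det_mult[OF assms(2) P'(1)] by simp
  then have "det P \<noteq> 0" by auto
  then show "det (four_block_mat P (0\<^sub>m d 1) x (1\<^sub>m 1)) \<noteq> 0"
    using det_four_block_mat_upper_right_zero[OF assms(2) refl assms(3), of "1\<^sub>m 1"] by simp
  show "four_block_mat P (0\<^sub>m d 1) x (1\<^sub>m 1) \<in> carrier_mat (d + 1) (d + 1)"
    using assms by auto
qed

lemma block_of_last_column:
  fixes M :: "'a::field mat"
  assumes M: "M \<in> carrier_mat (Suc d) (Suc d)" and c: "col M d = c \<cdot>\<^sub>v unit_vec (Suc d) d"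
  obtains M' r where "M' \<in> carrier_mat d d" "r \<in> carrier_mat 1 d"
    "M = four_block_mat M' (0\<^sub>m d 1) r (c \<cdot>\<^sub>m 1\<^sub>m 1)"
proof -
  have last: "M $$ (i, d) = (if i = d then c else 0)" if "i < Suc d" for i
    using M that arg_cong[OF c, of "\<lambda>v. v $ i"] by auto
  show ?thesis
    by (rule that[of "mat d d (\<lambda>(i, j). M $$ (i, j))" "mat 1 d (\<lambda>(i, j). M $$ (d, j))"])
      (use M last in \<open>auto intro!: eq_matI simp: less_Suc_eq\<close>)
qed

text \<open>
Splitting off one infinite eigenvector \<open>v\<close>: take \<open>v\<close> as last vector of the new basis of the domain
and \<open>A v\<close> as last vector of the new basis of the codomain.
\<close>
lemma strictly_equivalent_last_column:
  fixes E :: "'a::field mat"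
  assumes E: "E \<in> carrier_mat (Suc d) (Suc d)" and A: "A \<in> carrier_mat (Suc d) (Suc d)"
    and v: "v \<in> carrier_vec (Suc d)" "v \<noteq> 0\<^sub>v (Suc d)" "E *\<^sub>v v = 0\<^sub>v (Suc d)"
    and Av: "A *\<^sub>v v \<noteq> 0\<^sub>v (Suc d)"
  obtains E' r A' a where "E' \<in> carrier_mat d d" "A' \<in> carrier_mat d d"
    "r \<in> carrier_mat 1 d" "a \<in> carrier_mat 1 d"
    "strictly_equivalent (Suc d) E A (four_block_mat E' (0\<^sub>m d 1) r (0\<^sub>m 1 1))
       (four_block_mat A' (0\<^sub>m d 1) a (1\<^sub>m 1))"
proof -
  obtain T where T: "T \<in> carrier_mat (Suc d) (Suc d)" "invertible_mat T" "col T d = v"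
    by (rule mat_with_last_column[OF v(1,2)])
  have "A *\<^sub>v v \<in> carrier_vec (Suc d)" using A v(1) by auto
  then obtain S where S: "S \<in> carrier_mat (Suc d) (Suc d)" "invertible_mat S" "col S d = A *\<^sub>v v"
    by (rule mat_with_last_column[OF _ Av])
  obtain P where P: "P \<in> carrier_mat (Suc d) (Suc d)" "S * P = 1\<^sub>m (Suc d)" "P * S = 1\<^sub>m (Suc d)"
    by (rule invertible_mat_inverse[OF S(2,1)])
  have col: "col (P * X * T) d = P *\<^sub>v (X *\<^sub>v v)" if "X \<in> carrier_mat (Suc d) (Suc d)" for X
  proof -
    have "col (P * X * T) d = (P * X) *\<^sub>v v"
      using col_mult2[of "P * X" "Suc d" "Suc d" T "Suc d" d] P T that by auto
    also have "\<dots> = P *\<^sub>v (X *\<^sub>v v)"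
      using assoc_mult_mat_vec[of P "Suc d" "Suc d" X "Suc d" v] P that v by auto
    finally show ?thesis .
  qed
  have "col (P * E * T) d = 0 \<cdot>\<^sub>v unit_vec (Suc d) d"
    using v(3) mult_mat_zero_vec[OF P(1)] by (subst col[OF E]) (auto intro!: eq_vecI)
  then obtain E' r where E': "E' \<in> carrier_mat d d" "r \<in> carrier_mat 1 d"
    "P * E * T = four_block_mat E' (0\<^sub>m d 1) r (0 \<cdot>\<^sub>m 1\<^sub>m 1)"
    using block_of_last_column[of "P * E * T" d 0] P E T by auto
  have "col (P * A * T) d = 1 \<cdot>\<^sub>v unit_vec (Suc d) d"
    using col[OF A] S(3) P(3) col_mult2[OF P(1) S(1), of d] by simp
  then obtain A' a where A': "A' \<in> carrier_mat d d" "a \<in> carrier_mat 1 d"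
    "P * A * T = four_block_mat A' (0\<^sub>m d 1) a (1 \<cdot>\<^sub>m 1\<^sub>m 1)"
    using block_of_last_column[of "P * A * T" d 1] P A T by auto
  have one: "0 \<cdot>\<^sub>m 1\<^sub>m 1 = (0\<^sub>m 1 1 :: 'a mat)" "1 \<cdot>\<^sub>m 1\<^sub>m 1 = (1\<^sub>m 1 :: 'a mat)" by auto
  have "invertible_mat P" using P S by (intro invertible_matI[of _ _ S]) auto
  then have "strictly_equivalent (Suc d) E A (four_block_mat E' (0\<^sub>m d 1) r (0\<^sub>m 1 1))
       (four_block_mat A' (0\<^sub>m d 1) a (1\<^sub>m 1))"
    unfolding strictly_equivalent_def using P T E' A' by (auto simp only: one)
  with that E' A' show ?thesis by blast
qed

lemma lower_triangular_block_mult: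
  fixes P :: "'a::comm_ring_1 mat"
  assumes P: "P \<in> carrier_mat d d" and X: "X \<in> carrier_mat d d"
    and x: "x \<in> carrier_mat e d" and r: "r \<in> carrier_mat e d"
    and C: "C \<in> carrier_mat e e" and F: "F \<in> carrier_mat e e"
  shows "four_block_mat P (0\<^sub>m d e) x C * four_block_mat X (0\<^sub>m d e) r F
    = four_block_mat (P * X) (0\<^sub>m d e) (x * X + C * r) (C * F)"
proof -
  have c: "P * X \<in> carrier_mat d d" "x * X + C * r \<in> carrier_mat e d" "C * F \<in> carrier_mat e e"
    using assms by auto
  show ?thesis
    unfolding mult_four_block_mat[OF P zero_carrier_mat x C X zero_carrier_mat r F]
    using c left_mult_zero_mat[OF r, of d] left_mult_zero_mat[OF F, of d]
      right_mult_zero_mat[OF P, of e] right_mult_zero_mat[OF x, of e] right_add_zero_mat[OF c(1)]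
      left_add_zero_mat[OF c(3)] by simp
qed

text \<open>
An equivalence of the leading blocks extends to the bordered pencil.  The entries to the left of the
corner \<open>1\<close> in the second matrix are cleared by column operations, which do nothing to the first
matrix because its last column is zero.  The row operations remain free, and \<open>x\<close> records them: they
change the last row of the first matrix by a combination of the rows of \<open>D\<close>, while
their effect on the second matrix is undone by the columns.
\<close>
lemma strictly_equivalent_lift:
  fixes E :: "'a::field mat"
  assumes E: "E \<in> carrier_mat d d" and A: "A \<in> carrier_mat d d"
    and r: "r \<in> carrier_mat 1 d" and a: "a \<in> carrier_mat 1 d"
    and eq: "strictly_equivalent d E A D F"
  obtains \<rho> where "\<rho> \<in> carrier_mat 1 d"
    "\<forall>x \<in> carrier_mat 1 d. strictly_equivalent (Suc d)
       (four_block_mat E (0\<^sub>m d 1) r (0\<^sub>m 1 1)) (four_block_mat A (0\<^sub>m d 1) a (1\<^sub>m 1))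
       (four_block_mat D (0\<^sub>m d 1) (x * D + \<rho>) (0\<^sub>m 1 1)) (four_block_mat F (0\<^sub>m d 1) (0\<^sub>m 1 d) (1\<^sub>m 1))"
proof -
  from eq obtain P T where P: "P \<in> carrier_mat d d" and T: "T \<in> carrier_mat d d"
    and inv: "invertible_mat P" "invertible_mat T" and D: "P * E * T = D" and F: "P * A * T = F"
    by (auto simp: strictly_equivalent_def)
  show ?thesis
  proof (rule that[of "r * T"], safe)
    show "r * T \<in> carrier_mat 1 d" using r T by auto
    fix x :: "'a mat" assume x: "x \<in> carrier_mat 1 d"
    have xP: "x * P \<in> carrier_mat 1 d" using x P by auto
    \<comment> \<open>the column operation that clears the last row of the second matrix\<close>
    define y where "y = - ((x * P * A + a) * T)"
    have PX: "P * X \<in> carrier_mat d d" if "X \<in> carrier_mat d d" for X using P that by simp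
    have xPX: "x * P * X + w \<in> carrier_mat 1 d"
      if "X \<in> carrier_mat d d" "w \<in> carrier_mat 1 d" for X w using xP that by simp
    have y: "y \<in> carrier_mat 1 d" unfolding y_def using xPX[OF A a] T by simp
    let ?P = "four_block_mat P (0\<^sub>m d 1) (x * P) (1\<^sub>m 1)"
    let ?T = "four_block_mat T (0\<^sub>m d 1) y (1\<^sub>m 1)"
    have "?P * four_block_mat E (0\<^sub>m d 1) r (0\<^sub>m 1 1) * ?T
        = four_block_mat (P * E) (0\<^sub>m d 1) (x * P * E + r) (0\<^sub>m 1 1) * ?T"
      unfolding lower_triangular_block_mult[OF P E xP r one_carrier_mat zero_carrier_mat]
      using r by simp
    also have "\<dots> = four_block_mat (P * E * T) (0\<^sub>m d 1) ((x * P * E + r) * T) (0\<^sub>m 1 1)"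
      unfolding lower_triangular_block_mult[OF PX[OF E] T xPX[OF E r] y zero_carrier_mat one_carrier_mat]
      using y xPX[OF E r] T by simp
    also have "(x * P * E + r) * T = x * D + r * T"
    proof -
      have assoc: "x * P * E = x * (P * E)" "x * (P * E) * T = x * (P * E * T)"
        by (rule assoc_mult_mat[OF x P E], rule assoc_mult_mat[OF x PX[OF E] T])
      have "(x * P * E + r) * T = x * P * E * T + r * T"
        using xP E r T by (intro add_mult_distrib_mat[of _ 1 d _ _ d]) simp_all
      then show ?thesis unfolding assoc D .
    qed
    finally have 1: "?P * four_block_mat E (0\<^sub>m d 1) r (0\<^sub>m 1 1) * ?T
      = four_block_mat D (0\<^sub>m d 1) (x * D + r * T) (0\<^sub>m 1 1)" using D by simp
    have "?P * four_block_mat A (0\<^sub>m d 1) a (1\<^sub>m 1) * ?T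
        = four_block_mat (P * A) (0\<^sub>m d 1) (x * P * A + a) (1\<^sub>m 1) * ?T"
      unfolding lower_triangular_block_mult[OF P A xP a one_carrier_mat one_carrier_mat]
      using a by simp
    also have "\<dots> = four_block_mat F (0\<^sub>m d 1) ((x * P * A + a) * T + y) (1\<^sub>m 1)"
      unfolding lower_triangular_block_mult[OF PX[OF A] T xPX[OF A a] y one_carrier_mat one_carrier_mat]
      using y F by simp
    also have "(x * P * A + a) * T + y = 0\<^sub>m 1 d"
    proof -
      have "W + - W = 0\<^sub>m 1 d" if "W \<in> carrier_mat 1 d" for W :: "'a mat"
        using that by (intro eq_matI) auto
      then show ?thesis unfolding y_def using xPX[OF A a] T by simp
    qed
    finally have 2: "?P * four_block_mat A (0\<^sub>m d 1) a (1\<^sub>m 1) * ?T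
      = four_block_mat F (0\<^sub>m d 1) (0\<^sub>m 1 d) (1\<^sub>m 1)" .
    have "?P \<in> carrier_mat (Suc d) (Suc d)" "?T \<in> carrier_mat (Suc d) (Suc d)"
      using P T four_block_carrier_mat[of P d d "1\<^sub>m 1" 1 1] four_block_carrier_mat[of T d d "1\<^sub>m 1" 1 1]
      by auto
    with 1 2 show "strictly_equivalent (Suc d)
       (four_block_mat E (0\<^sub>m d 1) r (0\<^sub>m 1 1)) (four_block_mat A (0\<^sub>m d 1) a (1\<^sub>m 1))
       (four_block_mat D (0\<^sub>m d 1) (x * D + r * T) (0\<^sub>m 1 1))
       (four_block_mat F (0\<^sub>m d 1) (0\<^sub>m 1 d) (1\<^sub>m 1))"
      unfolding strictly_equivalent_def
      using triangular_block_invertible[OF inv(1) P xP] triangular_block_invertible[OF inv(2) T y]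
      by blast
  qed
qed

lemma pow_lower_triangular_block:
  fixes N :: "'a::field mat"
  assumes N: "N \<in> carrier_mat q q" and r: "r \<in> carrier_mat 1 q"
  shows "four_block_mat N (0\<^sub>m q 1) r (0\<^sub>m 1 1) ^\<^sub>m Suc k
    = four_block_mat (N ^\<^sub>m Suc k) (0\<^sub>m q 1) (r * N ^\<^sub>m k) (0\<^sub>m 1 1)"
proof (induction k)
  case 0
  then show ?case using N r four_block_carrier_mat[of N q q "0\<^sub>m 1 1" 1 1] by auto
next
  case (Suc k)
  have "four_block_mat N (0\<^sub>m q 1) r (0\<^sub>m 1 1) ^\<^sub>m Suc (Suc k) =
    four_block_mat (N ^\<^sub>m Suc k) (0\<^sub>m q 1) (r * N ^\<^sub>m k) (0\<^sub>m 1 1) * four_block_mat N (0\<^sub>m q 1) r (0\<^sub>m 1 1)"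
    by (simp only: Suc.IH pow_mat.simps(2)[of _ "Suc k"])
  also have "\<dots> = four_block_mat (N ^\<^sub>m Suc k * N) (0\<^sub>m q 1) (r * N ^\<^sub>m k * N) (0\<^sub>m 1 1)"
  proof -
    have c: "r * N ^\<^sub>m k \<in> carrier_mat 1 q" "r * N ^\<^sub>m k * N \<in> carrier_mat 1 q"
      by (rule mult_carrier_mat[OF r pow_carrier_mat[OF N]],
          rule mult_carrier_mat[OF mult_carrier_mat[OF r pow_carrier_mat[OF N]] N])
    show ?thesis
      unfolding lower_triangular_block_mult[OF pow_carrier_mat[OF N] N c(1) r zero_carrier_mat zero_carrier_mat]
      using r right_add_zero_mat[OF c(2)] by (simp del: pow_mat.simps One_nat_def)
  qed
  also have "r * N ^\<^sub>m k * N = r * N ^\<^sub>m Suc k"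
    using assoc_mult_mat[OF r pow_carrier_mat[OF N] N] by simp
  finally show ?case by simp
qed

text \<open>
Existence of the Weierstrass form over any field, by deflation.  If \<open>E\<close> is invertible, multiply by its
inverse.  Otherwise split off a kernel vector of \<open>E\<close> (regularity keeps \<open>A v\<close> nonzero), put the smaller
pencil into Weierstrass form, and use the free row operations to remove the coupling of the new row
to the identity block of \<open>E\<close>.  What is left of that row borders the nilpotent block, and the
bordered block is again nilpotent, of index at most one larger.
\<close>
lemma weierstrass_blocks_exist:
  fixes E :: "'a::field mat"
  assumes "E \<in> carrier_mat d d" "A \<in> carrier_mat d d" "det (pencil E A) \<noteq> 0"
  shows "\<exists>p q k A1 N. p + q = d \<and> A1 \<in> carrier_mat p p \<and> N \<in> carrier_mat q q \<and> N ^\<^sub>m k = 0\<^sub>m q q \<and>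
    strictly_equivalent d E A (four_block_mat (1\<^sub>m p) (0\<^sub>m p q) (0\<^sub>m q p) N)
      (four_block_mat A1 (0\<^sub>m p q) (0\<^sub>m q p) (1\<^sub>m q))"
  using assms
proof (induction d arbitrary: E A)
  case 0
  then have "strictly_equivalent 0 E A (four_block_mat (1\<^sub>m 0) (0\<^sub>m 0 0) (0\<^sub>m 0 0) (0\<^sub>m 0 0))
      (four_block_mat (0\<^sub>m 0 0) (0\<^sub>m 0 0) (0\<^sub>m 0 0) (1\<^sub>m 0))"
    unfolding strictly_equivalent_def
    by (auto intro!: bexI[of _ "1\<^sub>m 0"] invertible_matI[of _ 0 "1\<^sub>m 0"])
  then show ?case
    by (intro exI[of _ 0] exI[of _ "0\<^sub>m 0 0"] conjI) auto
next
  case (Suc d)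
  note E = Suc.prems(1) and A = Suc.prems(2)
  show ?case
  proof (cases "det E = 0")
    case False
    then have inv: "invertible_mat E" by (rule invertible_mat_det[OF E])
    obtain P where P: "P \<in> carrier_mat (Suc d) (Suc d)" "E * P = 1\<^sub>m (Suc d)" "P * E = 1\<^sub>m (Suc d)"
      by (rule invertible_mat_inverse[OF inv E])
    have "invertible_mat P" using P E by (intro invertible_matI[of _ "Suc d" E]) auto
    moreover have "invertible_mat (1\<^sub>m (Suc d) :: 'a mat)"
      by (rule invertible_matI[of _ "Suc d" "1\<^sub>m (Suc d)"]) auto
    moreover have "1\<^sub>m (Suc d) = four_block_mat (1\<^sub>m (Suc d)) (0\<^sub>m (Suc d) 0) (0\<^sub>m 0 (Suc d)) (0\<^sub>m 0 0 :: 'a mat)"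
      by (rule eq_matI) auto
    moreover have "P * A = four_block_mat (P * A) (0\<^sub>m (Suc d) 0) (0\<^sub>m 0 (Suc d)) (1\<^sub>m 0)"
      using P A by (intro eq_matI) auto
    ultimately have "strictly_equivalent (Suc d) E A
      (four_block_mat (1\<^sub>m (Suc d)) (0\<^sub>m (Suc d) 0) (0\<^sub>m 0 (Suc d)) (0\<^sub>m 0 0))
      (four_block_mat (P * A) (0\<^sub>m (Suc d) 0) (0\<^sub>m 0 (Suc d)) (1\<^sub>m 0))"
      unfolding strictly_equivalent_def using P A
      by (intro bexI[of _ P] bexI[of _ "1\<^sub>m (Suc d)"] conjI) auto
    then show ?thesis using P A
      by (intro exI[of _ "Suc d"] exI[of _ 0] exI[of _ "P * A"] exI[of _ "0\<^sub>m 0 0"] conjI) auto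
  next
    case True
    then obtain v where v: "v \<in> carrier_vec (Suc d)" "v \<noteq> 0\<^sub>v (Suc d)" "E *\<^sub>v v = 0\<^sub>v (Suc d)"
      using det_0_iff_vec_prod_zero[OF E] by auto
    have Av: "A *\<^sub>v v \<noteq> 0\<^sub>v (Suc d)"
      using det_pencil_common_kernel[OF E A v] Suc.prems(3) by blast
    obtain E' r A' a where c: "E' \<in> carrier_mat d d" "A' \<in> carrier_mat d d"
        "r \<in> carrier_mat 1 d" "a \<in> carrier_mat 1 d"
      and eq: "strictly_equivalent (Suc d) E A (four_block_mat E' (0\<^sub>m d 1) r (0\<^sub>m 1 1))
       (four_block_mat A' (0\<^sub>m d 1) a (1\<^sub>m 1))"
      by (rule strictly_equivalent_last_column[OF E A v Av])
    have "det (pencil E' A') \<noteq> 0"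
    proof -
      have "det (four_block_mat (pencil E' A') (0\<^sub>m d 1) (pencil r a) (pencil (0\<^sub>m 1 1) (1\<^sub>m 1))) \<noteq> 0"
        using strictly_equivalent_det_pencil[OF E A eq Suc.prems(3)] c
        by (simp add: pencil_four_block[of _ d d _ _ 1 _ _ 1])
      then show ?thesis using c
        by (subst (asm) det_four_block_mat_upper_right_zero[of _ d _ 1]) auto
    qed
    from Suc.IH[OF c(1,2) this] obtain p q k A1 N where
      pq: "p + q = d" and A1: "A1 \<in> carrier_mat p p" and N: "N \<in> carrier_mat q q"
      and Nk: "N ^\<^sub>m k = 0\<^sub>m q q"
      and eq': "strictly_equivalent d E' A' (four_block_mat (1\<^sub>m p) (0\<^sub>m p q) (0\<^sub>m q p) N)
        (four_block_mat A1 (0\<^sub>m p q) (0\<^sub>m q p) (1\<^sub>m q))" (is "strictly_equivalent _ _ _ ?D ?F")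
      by blast
    obtain \<rho> where \<rho>: "\<rho> \<in> carrier_mat 1 d"
      and lift: "\<forall>x \<in> carrier_mat 1 d. strictly_equivalent (Suc d)
         (four_block_mat E' (0\<^sub>m d 1) r (0\<^sub>m 1 1)) (four_block_mat A' (0\<^sub>m d 1) a (1\<^sub>m 1))
         (four_block_mat ?D (0\<^sub>m d 1) (x * ?D + \<rho>) (0\<^sub>m 1 1))
         (four_block_mat ?F (0\<^sub>m d 1) (0\<^sub>m 1 d) (1\<^sub>m 1))"
      by (rule strictly_equivalent_lift[OF c eq'])
    define \<rho>1 \<rho>2 where "\<rho>1 = mat 1 p (\<lambda>(i, j). \<rho> $$ (0, j))" and "\<rho>2 = mat 1 q (\<lambda>(i, j). \<rho> $$ (0, p + j))"
    have \<rho>_carrier: "\<rho>1 \<in> carrier_mat 1 p" "\<rho>2 \<in> carrier_mat 1 q" by (auto simp: \<rho>1_def \<rho>2_def)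
    have \<rho>_split: "\<rho> = four_block_mat \<rho>1 \<rho>2 (0\<^sub>m 0 p) (0\<^sub>m 0 q)"
      using \<rho> pq by (intro eq_matI) (auto simp: \<rho>1_def \<rho>2_def)
    \<comment> \<open>the row operation that cancels the part of the last row below the identity block\<close>
    define x where "x = four_block_mat (- \<rho>1) (0\<^sub>m 1 q) (0\<^sub>m 0 p) (0\<^sub>m 0 q)"
    have x: "x \<in> carrier_mat 1 d"
      using four_block_carrier_mat[of "- \<rho>1" 1 p "0\<^sub>m 0 q" 0 q] \<rho>_carrier pq by (auto simp: x_def)
    have "x * ?D = four_block_mat (- \<rho>1) (0\<^sub>m 1 q) (0\<^sub>m 0 p) (0\<^sub>m 0 q)"
      unfolding x_def using \<rho>_carrier N
      by (subst mult_four_block_mat[of _ 1 p _ q _ 0 _ _ p _ q]) auto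
    then have "x * ?D + \<rho> = four_block_mat (- \<rho>1 + \<rho>1) (0\<^sub>m 1 q + \<rho>2) (0\<^sub>m 0 p + 0\<^sub>m 0 p) (0\<^sub>m 0 q + 0\<^sub>m 0 q)"
      unfolding \<rho>_split using \<rho>_carrier
      by (simp only:) (rule add_four_block_mat[of _ 1 p _ q _ 0], auto)
    also have "\<dots> = four_block_mat (0\<^sub>m 1 p) \<rho>2 (0\<^sub>m 0 p) (0\<^sub>m 0 q)"
      using \<rho>_carrier uminus_l_inv_mat[of \<rho>1 1 p] by simp
    finally have row: "x * ?D + \<rho> = four_block_mat (0\<^sub>m 1 p) \<rho>2 (0\<^sub>m 0 p) (0\<^sub>m 0 q)" .
    define N' where "N' = four_block_mat N (0\<^sub>m q 1) \<rho>2 (0\<^sub>m 1 1)"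
    have N': "N' \<in> carrier_mat (Suc q) (Suc q)"
      using four_block_carrier_mat[OF N, of "0\<^sub>m 1 1" 1 1] by (simp add: N'_def)
    have "N' ^\<^sub>m Suc k = 0\<^sub>m (Suc q) (Suc q)"
    proof -
      have "N' ^\<^sub>m Suc k = four_block_mat (0\<^sub>m q q) (0\<^sub>m q 1) (0\<^sub>m 1 q) (0\<^sub>m 1 1)"
        unfolding N'_def using Nk N \<rho>_carrier by (subst pow_lower_triangular_block) auto
      also have "\<dots> = 0\<^sub>m (Suc q) (Suc q)" by (rule eq_matI) auto
      finally show ?thesis .
    qed
    moreover have "four_block_mat ?D (0\<^sub>m d 1) (x * ?D + \<rho>) (0\<^sub>m 1 1)
        = four_block_mat (1\<^sub>m p) (0\<^sub>m p (Suc q)) (0\<^sub>m (Suc q) p) N'"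
      unfolding row N'_def using pq N \<rho>_carrier by (intro eq_matI) auto
    moreover have "four_block_mat ?F (0\<^sub>m d 1) (0\<^sub>m 1 d) (1\<^sub>m 1)
        = four_block_mat A1 (0\<^sub>m p (Suc q)) (0\<^sub>m (Suc q) p) (1\<^sub>m (Suc q))"
      using pq A1 by (intro eq_matI) auto
    moreover note strictly_equivalent_trans[OF E A eq bspec[OF lift x]]
    ultimately show ?thesis using pq A1 N'
      by (intro exI[of _ p] exI[of _ "Suc q"] exI[of _ "Suc k"] exI[of _ A1] exI[of _ N'] conjI) auto
  qed
qed

section \<open>Chains at infinity and the Kronecker index\<close>

text \<open>
A Jordan chain of the pencil at the eigenvalue \<open>\<infinity>\<close>.  The index \<open>k\<close> counts the steps, so the chain
consists of the \<open>k + 1\<close> vectors \<open>z 0, \<dots>, z k\<close>; the later values of \<open>z\<close> only have to be vectors of the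
right size.
\<close>
definition chain_at_infinity :: "'a::field mat \<Rightarrow> 'a mat \<Rightarrow> nat \<Rightarrow> (nat \<Rightarrow> 'a vec) \<Rightarrow> bool" where
  "chain_at_infinity E A k z \<longleftrightarrow>
     (\<forall>i. z i \<in> carrier_vec (dim_col E)) \<and> z 0 \<noteq> 0\<^sub>v (dim_col E) \<and>
     E *\<^sub>v z 0 = 0\<^sub>v (dim_row E) \<and> (\<forall>i<k. E *\<^sub>v z (Suc i) = A *\<^sub>v z i)"

text \<open>
A singular pencil annihilates a nonzero polynomial vector.  Its coefficients, read from the leading
one downwards and continued by zeros, satisfy the chain equations without end.
\<close>
lemma singular_pencil_has_chain:
  fixes E :: "'a::field mat"
  assumes E: "E \<in> carrier_mat d d" and A: "A \<in> carrier_mat d d" and det: "det (pencil E A) = 0"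
  shows "\<exists>z. chain_at_infinity E A k z"
proof -
  obtain p where p: "p \<in> carrier_vec d" "p \<noteq> 0\<^sub>v d" and Kp: "pencil E A *\<^sub>v p = 0\<^sub>v d"
    using det det_0_iff_vec_prod_zero[OF pencil_carrier[OF A, of E]] by blast
  define \<zeta> where "\<zeta> j = map_vec (\<lambda>q. coeff q j) p" for j
  have \<zeta>: "\<zeta> j \<in> carrier_vec d" for j using p by (simp add: \<zeta>_def)
  have A0: "A *\<^sub>v \<zeta> 0 = 0\<^sub>v d"
  proof (rule eq_vecI)
    fix i assume "i < dim_vec (0\<^sub>v d :: 'a vec)"
    then show "(A *\<^sub>v \<zeta> 0) $ i = 0\<^sub>v d $ i"
      using coeff_pencil_mult_vec(1)[OF E A p(1), of i] Kp by (simp add: \<zeta>_def)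
  qed (use A in simp)
  have step: "E *\<^sub>v \<zeta> j = A *\<^sub>v \<zeta> (Suc j)" for j
  proof (rule eq_vecI)
    fix i assume "i < dim_vec (A *\<^sub>v \<zeta> (Suc j))"
    with A show "(E *\<^sub>v \<zeta> j) $ i = (A *\<^sub>v \<zeta> (Suc j)) $ i"
      using coeff_pencil_mult_vec(2)[OF E A p(1), of i j] Kp by (simp add: \<zeta>_def)
  qed (use E A in simp)
  \<comment> \<open>finitely many exponents occur in \<open>p\<close>; the largest one is the degree of \<open>p\<close>\<close>
  define J where "J = {j. \<zeta> j \<noteq> 0\<^sub>v d}"
  have "J \<subseteq> (\<Union>i<d. {..degree (p $ i)})"
  proof
    fix j assume "j \<in> J"
    have "\<exists>i<d. coeff (p $ i) j \<noteq> 0"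
    proof (rule ccontr)
      assume "\<not> ?thesis"
      then have "\<zeta> j = 0\<^sub>v d" using p by (intro eq_vecI) (auto simp: \<zeta>_def)
      with \<open>j \<in> J\<close> show False by (simp add: J_def)
    qed
    then show "j \<in> (\<Union>i<d. {..degree (p $ i)})" by (auto intro: le_degree)
  qed
  then have fin: "finite J" by (rule finite_subset) auto
  have "J \<noteq> {}"
  proof
    assume "J = {}"
    then have *: "\<zeta> j = 0\<^sub>v d" for j by (auto simp: J_def)
    have "p $ i = 0" if "i < d" for i
      using arg_cong[OF *, of "\<lambda>v. v $ i"] p that by (intro poly_eqI) (auto simp: \<zeta>_def)
    with p show False by (auto intro: eq_vecI)
  qed
  define D where "D = Max J"
  have D: "\<zeta> D \<noteq> 0\<^sub>v d" using Max_in[OF fin \<open>J \<noteq> {}\<close>] by (auto simp: J_def D_def)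
  have D': "\<zeta> (Suc D) = 0\<^sub>v d"
    using Max_ge[OF fin, of "Suc D"] by (auto simp: J_def D_def)
  define z where "z i = (if i \<le> D then \<zeta> (D - i) else 0\<^sub>v d)" for i
  have "E *\<^sub>v z (Suc i) = A *\<^sub>v z i" for i
  proof (cases "i < D")
    case True
    then show ?thesis using step[of "D - Suc i"] by (auto simp: z_def Suc_diff_Suc)
  next
    case False
    then show ?thesis using A0 mult_mat_zero_vec[OF A] mult_mat_zero_vec[OF E] by (cases "i = D") (auto simp: z_def)
  qed
  moreover have "E *\<^sub>v z 0 = 0\<^sub>v d" using step[of D] D' mult_mat_zero_vec[OF A] by (simp add: z_def)
  ultimately have "chain_at_infinity E A k z"
    using E D \<zeta> by (auto simp: chain_at_infinity_def z_def)
  then show ?thesis by blast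
qed

lemma pencil_inject:
  assumes "E \<in> carrier_mat a b" "A \<in> carrier_mat a b" "E' \<in> carrier_mat a b" "A' \<in> carrier_mat a b"
    and eq: "pencil E A = pencil E' A'"
  shows "E = E' \<and> A = A'"
proof -
  have "[:- A $$ (i, j), E $$ (i, j):] = [:- A' $$ (i, j), E' $$ (i, j):]" if "i < a" "j < b" for i j
    using arg_cong[OF eq, of "\<lambda>M. M $$ (i, j)"] that
    by (simp only: pencil_index[OF assms(1,2)] pencil_index[OF assms(3,4)])
  then have "E $$ (i, j) = E' $$ (i, j)" "A $$ (i, j) = A' $$ (i, j)" if "i < a" "j < b" for i j
    using that by auto
  then show ?thesis using assms by (auto intro!: eq_matI)
qed

text \<open>
Comparing the coefficients of \<open>s\<close> and of \<open>1\<close> turns the polynomial identity of the Weierstrass form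
into two identities between constant matrices.
\<close>
lemma weierstrass_form_constant:
  fixes E :: "'a::field mat"
  assumes E: "E \<in> carrier_mat d d"
  shows "weierstrass_form E A P T A1 N \<longleftrightarrow>
    (\<exists>p q. p + q = d \<and> A \<in> carrier_mat d d \<and> P \<in> carrier_mat d d \<and> T \<in> carrier_mat d d \<and>
       A1 \<in> carrier_mat p p \<and> N \<in> carrier_mat q q \<and>
       invertible_mat P \<and> invertible_mat T \<and> nilpotent_mat N \<and>
       P * E * T = four_block_mat (1\<^sub>m p) (0\<^sub>m p q) (0\<^sub>m q p) N \<and>
       P * A * T = four_block_mat A1 (0\<^sub>m p q) (0\<^sub>m q p) (1\<^sub>m q))"
    (is "_ \<longleftrightarrow> (\<exists>p q. ?R p q)")
proof -
  have key: "const_poly_mat P * pencil E A * const_poly_mat T =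
        four_block_mat (pencil (1\<^sub>m p) A1) (0\<^sub>m p q) (0\<^sub>m q p) (pencil N (1\<^sub>m q)) \<longleftrightarrow>
      P * E * T = four_block_mat (1\<^sub>m p) (0\<^sub>m p q) (0\<^sub>m q p) N \<and>
      P * A * T = four_block_mat A1 (0\<^sub>m p q) (0\<^sub>m q p) (1\<^sub>m q)" (is "?L \<longleftrightarrow> ?E \<and> ?A")
    if c: "p + q = d" "A \<in> carrier_mat d d" "P \<in> carrier_mat d d" "T \<in> carrier_mat d d"
       "A1 \<in> carrier_mat p p" "N \<in> carrier_mat q q" for p q
  proof -
    have "four_block_mat (pencil (1\<^sub>m p) A1) (0\<^sub>m p q) (0\<^sub>m q p) (pencil N (1\<^sub>m q)) =
        pencil (four_block_mat (1\<^sub>m p) (0\<^sub>m p q) (0\<^sub>m q p) N)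
          (four_block_mat A1 (0\<^sub>m p q) (0\<^sub>m q p) (1\<^sub>m q))"
      using c by (subst pencil_four_block[of _ p p _ _ q _ _ q]) auto
    moreover have "four_block_mat (1\<^sub>m p) (0\<^sub>m p q) (0\<^sub>m q p) N \<in> carrier_mat d d"
      "four_block_mat A1 (0\<^sub>m p q) (0\<^sub>m q p) (1\<^sub>m q) \<in> carrier_mat d d"
      using c by (auto simp flip: c(1))
    moreover have "P * E * T \<in> carrier_mat d d" "P * A * T \<in> carrier_mat d d" using c E by auto
    ultimately show ?thesis
      using pencil_mult[OF c(3,4) E c(2)] pencil_inject[of "P * E * T" d d "P * A * T"] by metis
  qed
  have d: "dim_row E = d" using E by simp
  show ?thesis
  proof
    assume W: "weierstrass_form E A P T A1 N"
    have "?R (dim_row A1) (dim_row N)"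
      using W key[of "dim_row A1" "dim_row N"]
      unfolding weierstrass_form_def Let_def d by (auto simp del: carrier_matD)
    then show "\<exists>p q. ?R p q" by blast
  next
    assume "\<exists>p q. ?R p q"
    then obtain p q where R: "?R p q" by blast
    then have "dim_row A1 = p" "dim_row N = q" by auto
    with R key[of p q] E show "weierstrass_form E A P T A1 N"
      unfolding weierstrass_form_def Let_def d by auto
  qed
qed

lemma pow_mat_mult_vec_Suc:
  fixes N :: "'a::field mat"
  assumes N: "N \<in> carrier_mat q q" and w: "w \<in> carrier_vec q"
  shows "N ^\<^sub>m Suc k *\<^sub>v w = N ^\<^sub>m k *\<^sub>v (N *\<^sub>v w)"
    and "N ^\<^sub>m Suc k *\<^sub>v w = N *\<^sub>v (N ^\<^sub>m k *\<^sub>v w)"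
proof -
  have 1: "N ^\<^sub>m Suc k *\<^sub>v w = N ^\<^sub>m k *\<^sub>v (N *\<^sub>v w)" if "w \<in> carrier_vec q" for k w
    using assoc_mult_mat_vec[OF pow_carrier_mat[OF N] N that] by simp
  then show "N ^\<^sub>m Suc k *\<^sub>v w = N ^\<^sub>m k *\<^sub>v (N *\<^sub>v w)" using w .
  show "N ^\<^sub>m Suc k *\<^sub>v w = N *\<^sub>v (N ^\<^sub>m k *\<^sub>v w)"
    using w
  proof (induction k arbitrary: w)
    case 0
    then show ?case using N by simp
  next
    case (Suc k)
    have Nw: "N *\<^sub>v w \<in> carrier_vec q" using N Suc.prems by auto
    show ?case using 1[OF Suc.prems, of "Suc k"] 1[OF Suc.prems, of k] Suc.IH[OF Nw] by simp
  qed
qed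

lemma mat_nonzero_imp_vec:
  fixes M :: "'a::field mat"
  assumes M: "M \<in> carrier_mat a b" and "M \<noteq> 0\<^sub>m a b"
  obtains w where "w \<in> carrier_vec b" "M *\<^sub>v w \<noteq> 0\<^sub>v a"
proof -
  obtain i j where ij: "i < a" "j < b" "M $$ (i, j) \<noteq> 0"
  proof (rule ccontr)
    assume "\<not> thesis"
    with that have "M $$ (i, j) = 0" if "i < a" "j < b" for i j using that by blast
    then have "M = 0\<^sub>m a b" using M by (intro eq_matI) auto
    with assms(2) show False by simp
  qed
  then have "(M *\<^sub>v unit_vec b j) $ i \<noteq> 0" using M by simp
  then have "M *\<^sub>v unit_vec b j \<noteq> 0\<^sub>v a" using ij by auto
  then show ?thesis using that[of "unit_vec b j"] by simp
qed

text \<open>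
In the coordinates of the Weierstrass form, \<open>z i\<close> splits into \<open>u i\<close> and \<open>w i\<close>.  The chain equations
force \<open>u 0 = 0\<close> and \<open>N (w (i + 1)) = w i\<close>, with \<open>N (w 0) = 0\<close>; so \<open>w 0 = N\<^sup>k (w k)\<close>, which
is nonzero because \<open>z 0\<close> is.
Conversely, iterating \<open>N\<close> on a suitable vector gives a chain with \<open>u = 0\<close>.
\<close>
lemma weierstrass_nilpotent_pow_iff_chain:
  fixes E :: "'a::field mat"
  assumes E: "E \<in> carrier_mat d d" and W: "weierstrass_form E A P T A1 N"
  shows "N ^\<^sub>m k \<noteq> 0\<^sub>m (dim_row N) (dim_row N) \<longleftrightarrow> (\<exists>z. chain_at_infinity E A k z)"
proof -
  from W obtain p q where pq: "p + q = d" and A: "A \<in> carrier_mat d d" and P: "P \<in> carrier_mat d d"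
    and T: "T \<in> carrier_mat d d" and A1: "A1 \<in> carrier_mat p p" and N: "N \<in> carrier_mat q q"
    and inv: "invertible_mat P" "invertible_mat T" and nil: "nilpotent_mat N"
    and PET: "P * E * T = four_block_mat (1\<^sub>m p) (0\<^sub>m p q) (0\<^sub>m q p) N"
    and PAT: "P * A * T = four_block_mat A1 (0\<^sub>m p q) (0\<^sub>m q p) (1\<^sub>m q)"
    unfolding weierstrass_form_constant[OF E] by blast
  obtain P' where P': "P' \<in> carrier_mat d d" "P' * P = 1\<^sub>m d"
    by (rule invertible_mat_inverse[OF inv(1) P])
  obtain T' where T': "T' \<in> carrier_mat d d" "T * T' = 1\<^sub>m d" "T' * T = 1\<^sub>m d"
    by (rule invertible_mat_inverse[OF inv(2) T])
  have TT': "T *\<^sub>v (T' *\<^sub>v v) = v" "T' *\<^sub>v (T *\<^sub>v v) = v" if "v \<in> carrier_vec d" for v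
    using that T T' assoc_mult_mat_vec[of T d d T' d v] assoc_mult_mat_vec[of T' d d T d v] by auto
  have PXT: "P *\<^sub>v (X *\<^sub>v (T *\<^sub>v v)) = (P * X * T) *\<^sub>v v"
    if "X \<in> carrier_mat d d" "v \<in> carrier_vec d" for X v
    using that P T assoc_mult_mat_vec[of "P * X" d d T d v] assoc_mult_mat_vec[of P d d X d "T *\<^sub>v v"]
    by auto
  have P_inj: "v = w" if "P *\<^sub>v v = P *\<^sub>v w" "v \<in> carrier_vec d" "w \<in> carrier_vec d" for v w
    using that P P' assoc_mult_mat_vec[of P' d d P d] by (metis one_mult_mat_vec)
  have PE: "P *\<^sub>v (E *\<^sub>v (T *\<^sub>v (u @\<^sub>v w))) = u @\<^sub>v (N *\<^sub>v w)"
    and PA: "P *\<^sub>v (A *\<^sub>v (T *\<^sub>v (u @\<^sub>v w))) = (A1 *\<^sub>v u) @\<^sub>v w"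
    if "u \<in> carrier_vec p" "w \<in> carrier_vec q" for u w
    using that N A1 pq PXT[OF E, of "u @\<^sub>v w"] PXT[OF A, of "u @\<^sub>v w"]
      mult_mat_vec_split[OF one_carrier_mat N that] mult_mat_vec_split[OF A1 one_carrier_mat that]
    by (auto simp: PET PAT)
  have d: "dim_row E = d" "dim_col E = d" "dim_row N = q" using E N by auto
  have zero_append: "0\<^sub>v d = 0\<^sub>v p @\<^sub>v 0\<^sub>v q" using pq by (intro eq_vecI) auto
  show ?thesis unfolding d
  proof
    assume Nk: "N ^\<^sub>m k \<noteq> 0\<^sub>m q q"
    \<comment> \<open>The first vector of the chain must lie in the kernel of \<open>N\<close>.  It is therefore taken from the
      range of the last nonvanishing power, which may lie beyond \<open>k\<close>.\<close>
    have "\<exists>j\<ge>k. N ^\<^sub>m j \<noteq> 0\<^sub>m q q \<and> N ^\<^sub>m Suc j = 0\<^sub>m q q"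
    proof (rule ccontr)
      assume no: "\<not> ?thesis"
      have "N ^\<^sub>m j \<noteq> 0\<^sub>m q q" if "k \<le> j" for j
        using that by (induction rule: dec_induct) (use Nk no in blast)+
      moreover obtain e where e: "N ^\<^sub>m e = 0\<^sub>m q q" using nil N by (auto simp: nilpotent_mat_def)
      have "N ^\<^sub>m (e + l) = 0\<^sub>m q q" for l
        using N e by (induction l) auto
      ultimately show False using le_add2 by blast
    qed
    then obtain j where j: "k \<le> j" "N ^\<^sub>m j \<noteq> 0\<^sub>m q q" "N ^\<^sub>m Suc j = 0\<^sub>m q q" by blast
    obtain w where w: "w \<in> carrier_vec q" "N ^\<^sub>m j *\<^sub>v w \<noteq> 0\<^sub>v q"
      by (rule mat_nonzero_imp_vec[OF pow_carrier_mat[OF N] j(2)])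
    define v where "v i = N ^\<^sub>m (j - i) *\<^sub>v w" for i
    have v: "v i \<in> carrier_vec q" for i
      using mult_mat_vec_carrier[OF pow_carrier_mat[OF N] w(1)] by (simp add: v_def)
    have Nv: "N *\<^sub>v v (Suc i) = v i" if "i < j" for i
      using pow_mat_mult_vec_Suc(2)[OF N w(1), of "j - Suc i"] that by (simp add: v_def Suc_diff_Suc)
    have "0\<^sub>m q q *\<^sub>v w = 0\<^sub>v q" using w(1) by auto
    then have Nv0: "N *\<^sub>v v 0 = 0\<^sub>v q"
      using pow_mat_mult_vec_Suc(2)[OF N w(1), of j] j(3) by (simp add: v_def del: pow_mat.simps)
    have pv: "0\<^sub>v p @\<^sub>v v i \<in> carrier_vec d" for i
      using append_carrier_vec[OF zero_carrier_vec v, of p i] pq by simp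
    define z where "z i = T *\<^sub>v (0\<^sub>v p @\<^sub>v v i)" for i
    have z: "z i \<in> carrier_vec d" for i using mult_mat_vec_carrier[OF T pv] by (simp add: z_def)
    have "z 0 \<noteq> 0\<^sub>v d"
    proof
      assume "z 0 = 0\<^sub>v d"
      then have "0\<^sub>v p @\<^sub>v v 0 = 0\<^sub>v p @\<^sub>v 0\<^sub>v q"
        using TT'(2)[OF pv, of 0] mult_mat_zero_vec[OF T'(1)] by (simp add: z_def zero_append)
      then have "v 0 = 0\<^sub>v q"
        using append_vec_eq[of "0\<^sub>v p :: 'a vec" p "0\<^sub>v p" "v 0" "0\<^sub>v q"] by simp
      then show False using w(2) by (simp add: v_def)
    qed
    moreover have "E *\<^sub>v z 0 = 0\<^sub>v d"
    proof (rule P_inj)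
      show "P *\<^sub>v (E *\<^sub>v z 0) = P *\<^sub>v 0\<^sub>v d"
        using PE[OF zero_carrier_vec v, of 0] Nv0 mult_mat_zero_vec[OF P] by (simp add: z_def zero_append)
    qed (use mult_mat_vec_carrier[OF E z] in auto)
    moreover have "E *\<^sub>v z (Suc i) = A *\<^sub>v z i" if "i < j" for i
    proof (rule P_inj)
      show "P *\<^sub>v (E *\<^sub>v z (Suc i)) = P *\<^sub>v (A *\<^sub>v z i)"
        using PE[OF zero_carrier_vec v, of "Suc i"] PA[OF zero_carrier_vec v, of i] Nv[OF that] mult_mat_zero_vec[OF A1]
        by (simp add: z_def)
    qed (use mult_mat_vec_carrier[OF E z] mult_mat_vec_carrier[OF A z] in auto)
    ultimately have "chain_at_infinity E A k z"
      using z j(1) by (auto simp: chain_at_infinity_def d)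
    then show "\<exists>z. chain_at_infinity E A k z" by blast
  next
    assume "\<exists>z. chain_at_infinity E A k z"
    then obtain z where z: "\<And>i. z i \<in> carrier_vec d" "z 0 \<noteq> 0\<^sub>v d" "E *\<^sub>v z 0 = 0\<^sub>v d"
      and step: "\<And>i. i < k \<Longrightarrow> E *\<^sub>v z (Suc i) = A *\<^sub>v z i"
      by (auto simp: chain_at_infinity_def d)
    define u where "u i = vec_first (T' *\<^sub>v z i) p" for i
    define w where "w i = vec_last (T' *\<^sub>v z i) q" for i
    have u: "u i \<in> carrier_vec p" and w: "w i \<in> carrier_vec q" for i by (auto simp: u_def w_def)
    have zi: "z i = T *\<^sub>v (u i @\<^sub>v w i)" for i
    proof -
      have "T' *\<^sub>v z i \<in> carrier_vec (p + q)" using T' z pq by auto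
      then show ?thesis unfolding u_def w_def using TT'(1)[OF z(1)] by simp
    qed
    have "u 0 @\<^sub>v (N *\<^sub>v w 0) = 0\<^sub>v p @\<^sub>v 0\<^sub>v q"
      using PE[OF u w, of 0 0] z(3) mult_mat_zero_vec[OF P] by (simp flip: zi zero_append)
    then have u0: "u 0 = 0\<^sub>v p" using u append_vec_eq[of "u 0" p "0\<^sub>v p"] by auto
    have w0: "w 0 \<noteq> 0\<^sub>v q"
      using zi[of 0] z(2) u0 mult_mat_zero_vec[OF T] by (auto simp flip: zero_append)
    have Nw: "N *\<^sub>v w (Suc i) = w i" if "i < k" for i
      using PE[OF u w, of "Suc i" "Suc i"] PA[OF u w, of i i] step[OF that] u A1
        append_vec_eq[of "u (Suc i)" p "A1 *\<^sub>v u i"] by (auto simp flip: zi)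
    have "i \<le> k \<Longrightarrow> N ^\<^sub>m i *\<^sub>v w i = w 0" for i
    proof (induction i)
      case 0
      then show ?case using w N by simp
    next
      case (Suc i)
      then show ?case using pow_mat_mult_vec_Suc(1)[OF N w, of i "Suc i"] Nw[of i] by simp
    qed
    from this[of k] have "N ^\<^sub>m k *\<^sub>v w k = w 0" by simp
    moreover have "0\<^sub>m q q *\<^sub>v w k = 0\<^sub>v q" using w by auto
    ultimately show "N ^\<^sub>m k \<noteq> 0\<^sub>m q q" using w0 by metis
  qed
qed

text \<open>
The right-hand side implies regularity, because a singular pencil has chains of every length; it
thereby provides a Weierstrass form, whose nilpotent block has the required index.
\<close>
theorem kronecker_index_iff_chains:
  fixes E :: "'a::field mat"
  assumes E: "E \<in> carrier_mat d d" and A: "A \<in> carrier_mat d d"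
  shows "regular_pencil E A \<and> has_kronecker_index E A (Suc k) \<longleftrightarrow>
    (\<exists>z. chain_at_infinity E A k z) \<and> (\<nexists>z. chain_at_infinity E A (Suc k) z)"
proof -
  have index: "nilpotency_index N = Suc k \<longleftrightarrow>
      (\<exists>z. chain_at_infinity E A k z) \<and> (\<nexists>z. chain_at_infinity E A (Suc k) z)"
    if W: "weierstrass_form E A P T A1 N" for P T A1 N
  proof -
    let ?zero = "0\<^sub>m (dim_row N) (dim_row N)"
    from W have "nilpotent_mat N" by (auto simp: weierstrass_form_def Let_def)
    then obtain e where "N ^\<^sub>m e = ?zero" by (auto simp: nilpotent_mat_def)
    then have least: "N ^\<^sub>m nilpotency_index N = ?zero"
      unfolding nilpotency_index_def by (rule LeastI)
    have shorter: "N ^\<^sub>m i = ?zero \<Longrightarrow> nilpotency_index N \<le> i" for i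
      unfolding nilpotency_index_def by (rule Least_le)
    have chain_mono: "\<exists>z. chain_at_infinity E A i z" if "\<exists>z. chain_at_infinity E A j z" "i \<le> j" for i j
    proof -
      from that obtain z where "chain_at_infinity E A j z" by blast
      then have "chain_at_infinity E A i z" using that(2) by (simp add: chain_at_infinity_def)
      then show ?thesis by blast
    qed
    note pow_iff = weierstrass_nilpotent_pow_iff_chain[OF E W]
    have "N ^\<^sub>m i \<noteq> ?zero \<longleftrightarrow> i < nilpotency_index N" for i
      using least shorter[of i] chain_mono[of i "nilpotency_index N"] chain_mono[of "nilpotency_index N" i] pow_iff
      by (metis not_le)
    then show ?thesis unfolding pow_iff[symmetric] by (metis less_Suc_eq not_less_eq)
  qed
  show ?thesis
  proof
    assume "regular_pencil E A \<and> has_kronecker_index E A (Suc k)"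
    then show "(\<exists>z. chain_at_infinity E A k z) \<and> (\<nexists>z. chain_at_infinity E A (Suc k) z)"
      using index by (auto simp: has_kronecker_index_def)
  next
    assume chains: "(\<exists>z. chain_at_infinity E A k z) \<and> (\<nexists>z. chain_at_infinity E A (Suc k) z)"
    then have det: "det (pencil E A) \<noteq> 0" using singular_pencil_has_chain[OF E A] by blast
    from weierstrass_blocks_exist[OF E A det] obtain p q e A1 N P T
      where "p + q = d" "A1 \<in> carrier_mat p p" "N \<in> carrier_mat q q" "N ^\<^sub>m e = 0\<^sub>m q q"
        "P \<in> carrier_mat d d" "T \<in> carrier_mat d d" "invertible_mat P" "invertible_mat T"
        "P * E * T = four_block_mat (1\<^sub>m p) (0\<^sub>m p q) (0\<^sub>m q p) N"
        "P * A * T = four_block_mat A1 (0\<^sub>m p q) (0\<^sub>m q p) (1\<^sub>m q)"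
      unfolding strictly_equivalent_def by blast
    then have "weierstrass_form E A P T A1 N"
      unfolding weierstrass_form_constant[OF E] using A by (auto simp: nilpotent_mat_def)
    moreover have "regular_pencil E A"
      using det pencil_carrier[OF A, of E] by (simp add: regular_pencil_def)
    ultimately show "regular_pencil E A \<and> has_kronecker_index E A (Suc k)"
      using index chains unfolding has_kronecker_index_def by blast
  qed
qed

section \<open>Block vectors\<close>

lemma nine_block_mult_vec:
  fixes A11 :: "'a::field mat"
  assumes c: "A11 \<in> carrier_mat a1 b1" "A12 \<in> carrier_mat a1 b2" "A13 \<in> carrier_mat a1 b3"
    "A21 \<in> carrier_mat a2 b1" "A22 \<in> carrier_mat a2 b2" "A23 \<in> carrier_mat a2 b3"
    "A31 \<in> carrier_mat a3 b1" "A32 \<in> carrier_mat a3 b2" "A33 \<in> carrier_mat a3 b3"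
    and v: "x \<in> carrier_vec b1" "y \<in> carrier_vec b2" "u \<in> carrier_vec b3"
  shows "nine_block_mat A11 A12 A13 A21 A22 A23 A31 A32 A33 *\<^sub>v ((x @\<^sub>v y) @\<^sub>v u) =
    ((A11 *\<^sub>v x + A12 *\<^sub>v y + A13 *\<^sub>v u) @\<^sub>v (A21 *\<^sub>v x + A22 *\<^sub>v y + A23 *\<^sub>v u)) @\<^sub>v
    (A31 *\<^sub>v x + A32 *\<^sub>v y + A33 *\<^sub>v u)"
proof -
  let ?L = "four_block_mat A11 A12 A21 A22" and ?R = "A13 @\<^sub>r A23"
  let ?B = "(A31\<^sup>T @\<^sub>r A32\<^sup>T)\<^sup>T"
  have L: "?L \<in> carrier_mat (a1 + a2) (b1 + b2)" using c by auto
  have R: "?R \<in> carrier_mat (a1 + a2) b3" using c by auto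
  have "?B = four_block_mat A31 A32 (0\<^sub>m 0 b1) (0\<^sub>m 0 b2)"
    unfolding append_rows_def using c by (intro eq_matI) auto
  then have Bv: "?B *\<^sub>v (x @\<^sub>v y) = A31 *\<^sub>v x + A32 *\<^sub>v y"
    using c v by (simp add: four_block_mat_mult_vec[of _ a3 b1 _ b2 _ 0]) (auto intro!: eq_vecI)
  have B: "?B \<in> carrier_mat a3 (b1 + b2)" using c by auto
  have Lv: "?L *\<^sub>v (x @\<^sub>v y) = (A11 *\<^sub>v x + A12 *\<^sub>v y) @\<^sub>v (A21 *\<^sub>v x + A22 *\<^sub>v y)"
    using c v by (intro four_block_mat_mult_vec) auto
  have Ru: "?R *\<^sub>v u = (A13 *\<^sub>v u) @\<^sub>v (A23 *\<^sub>v u)"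
    using c v by (intro mat_mult_append) auto
  have xy: "x @\<^sub>v y \<in> carrier_vec (b1 + b2)" using v by auto
  have cv: "A11 *\<^sub>v x + A12 *\<^sub>v y \<in> carrier_vec a1" "A13 *\<^sub>v u \<in> carrier_vec a1"
    "A21 *\<^sub>v x + A22 *\<^sub>v y \<in> carrier_vec a2" "A23 *\<^sub>v u \<in> carrier_vec a2"
    using c v by auto
  show ?thesis
    unfolding nine_block_mat_def four_block_mat_mult_vec[OF L R B c(9) xy v(3)] Lv Ru Bv
      append_vec_add[OF cv] ..
qed

lemma triple_vec_eq_iff:
  assumes "x \<in> carrier_vec n" "x' \<in> carrier_vec n" "y \<in> carrier_vec n" "y' \<in> carrier_vec n"
  shows "(x @\<^sub>v y) @\<^sub>v u = (x' @\<^sub>v y') @\<^sub>v u' \<longleftrightarrow> x = x' \<and> y = y' \<and> u = u'"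
  using assms append_vec_eq[of "x @\<^sub>v y" "n + n" "x' @\<^sub>v y'"] append_vec_eq[of x n x'] by auto

section \<open>Positive semidefinite matrices\<close>

lemma index_mat_adjoint:
  assumes "M \<in> carrier_mat a b" "i < b" "j < a"
  shows "mat_adjoint M $$ (i, j) = conjugate (M $$ (j, i))"
  using assms by (auto simp: mat_adjoint_def mat_of_rows_def)

lemma mat_adjoint_carrier [simp]:
  "M \<in> carrier_mat a b \<Longrightarrow> mat_adjoint M \<in> carrier_mat b a"
  by (auto simp: mat_adjoint_def)

lemma scalar_prod_mat_adjoint:
  fixes M :: "'a::conjugatable_field mat"
  assumes M: "M \<in> carrier_mat a b" and x: "x \<in> carrier_vec b" and y: "y \<in> carrier_vec a"
  shows "conjugate x \<bullet> (mat_adjoint M *\<^sub>v y) = conjugate (M *\<^sub>v x) \<bullet> y"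
proof -
  have "conjugate x \<bullet> (mat_adjoint M *\<^sub>v y) =
      (\<Sum>i = 0..<b. \<Sum>j = 0..<a. conjugate (x $ i) * (conjugate (M $$ (j, i)) * y $ j))"
    using assms carrier_matD[OF mat_adjoint_carrier[OF M]]
    by (auto simp: scalar_prod_def index_mat_adjoint[OF M] sum_distrib_left)
  also have "\<dots> = (\<Sum>j = 0..<a. \<Sum>i = 0..<b. conjugate (x $ i) * (conjugate (M $$ (j, i)) * y $ j))"
    by (rule sum.swap)
  also have "\<dots> = conjugate (M *\<^sub>v x) \<bullet> y"
    using assms by (auto simp: scalar_prod_def sum_conjugate conjugate_dist_mul sum_distrib_right
      intro!: sum.cong)
  finally show ?thesis .
qed

lemma mult_mat_vec_smult:
  fixes M :: "'a::field mat"
  assumes "M \<in> carrier_mat a b" "x \<in> carrier_vec b"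
  shows "M *\<^sub>v (c \<cdot>\<^sub>v x) = c \<cdot>\<^sub>v (M *\<^sub>v x)"
  using assms by (intro eq_vecI) auto

lemma mult_mat_vec_uminus:
  fixes M :: "'a::field mat"
  assumes "M \<in> carrier_mat a b" "x \<in> carrier_vec b"
  shows "M *\<^sub>v (- x) = - (M *\<^sub>v x)"
  using assms by (intro eq_vecI) auto

text \<open>
With \<open>z = R x\<close>, \<open>c = z\<^sup>H z\<close> and \<open>r = z\<^sup>H R z\<close>, the form at \<open>s x - t z\<close> (for self-conjugate \<open>s\<close>, \<open>t\<close>) equals
\<open>t\<^sup>2 r - 2 s t c\<close>.  This is \<open>- r c\<^sup>2\<close> for \<open>s = r\<close>, \<open>t = c\<close>, and \<open>- 2 c\<close> for \<open>s = t = 1\<close> if \<open>r = 0\<close>; both force \<open>c = 0\<close>.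
The order on the scalars is only known to be compatible with addition, so that \<open>r c\<^sup>2 \<ge> 0\<close> has to be
obtained as a value of the form as well.
\<close>
lemma psd_form_zero_imp_kernel:
  fixes R :: "'a::conjugatable_ordered_field mat"
  assumes R: "R \<in> carrier_mat n n" and herm: "R = mat_adjoint R" and psd: "psd_mat n R"
    and x: "x \<in> carrier_vec n" and zero: "conjugate x \<bullet> (R *\<^sub>v x) = 0"
  shows "R *\<^sub>v x = 0\<^sub>v n"
proof -
  define z where "z = R *\<^sub>v x"
  have z: "z \<in> carrier_vec n" using mult_mat_vec_carrier[OF R x] by (simp add: z_def)
  have Rz: "R *\<^sub>v z \<in> carrier_vec n" using mult_mat_vec_carrier[OF R z] .
  define c where "c = z \<bullet>c z"
  define r where "r = conjugate z \<bullet> (R *\<^sub>v z)"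
  have c: "conjugate z \<bullet> z = c" using conjugate_vec_sprod_comm[OF z z] by (simp add: c_def)
  have xRz: "conjugate x \<bullet> (R *\<^sub>v z) = c"
    using scalar_prod_mat_adjoint[OF R x z] herm c by (simp add: z_def)
  have form: "conjugate (s \<cdot>\<^sub>v x - t \<cdot>\<^sub>v z) \<bullet> (R *\<^sub>v (s \<cdot>\<^sub>v x - t \<cdot>\<^sub>v z))
      = - (conjugate s * t * c) - conjugate t * s * c + conjugate t * t * r" for s t
  proof -
    have "R *\<^sub>v (s \<cdot>\<^sub>v x - t \<cdot>\<^sub>v z) = s \<cdot>\<^sub>v z - t \<cdot>\<^sub>v (R *\<^sub>v z)"
      using R x z by (subst mult_minus_distrib_mat_vec[of _ n n]) (auto simp: mult_mat_vec_smult[OF R] z_def)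
    moreover have "conjugate (s \<cdot>\<^sub>v x - t \<cdot>\<^sub>v z) = conjugate s \<cdot>\<^sub>v conjugate x - conjugate t \<cdot>\<^sub>v conjugate z"
      using x z conjugate_dist_add[of "_ :: 'a" "- _"]
      by (intro eq_vecI) (auto simp: conjugate_dist_mul conjugate_neg)
    ultimately show ?thesis
      using x z Rz zero c xRz
      by (simp add: smult_scalar_prod_distrib[of _ n] scalar_prod_smult_distrib[of _ n]
        minus_scalar_prod_distrib[of _ n] scalar_prod_minus_distrib[of _ n]
        r_def[symmetric] z_def[symmetric] algebra_simps)
  qed
  have nonneg: "0 \<le> - (conjugate s * t * c) - conjugate t * s * c + conjugate t * t * r" for s t
    using psd x z unfolding form[symmetric] psd_mat_def by simp
  have c0: "0 \<le> c" using conjugate_square_ge_0_vec[of z] by (simp add: c_def)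
  have cc: "conjugate c = c" using conjugate_conjugate_sprod[OF z z] c by (simp add: c_def)
  have rr: "conjugate r = r"
  proof -
    have "conjugate r = z \<bullet>c (R *\<^sub>v z)" unfolding r_def using z Rz by (rule conjugate_conjugate_sprod)
    also have "\<dots> = conjugate (R *\<^sub>v z) \<bullet> z" using z Rz by (rule conjugate_vec_sprod_comm)
    also have "\<dots> = r" using scalar_prod_mat_adjoint[OF R z z] herm by (simp add: r_def)
    finally show ?thesis .
  qed
  have "c = 0"
  proof (cases "r = 0")
    case True
    have "conjugate (1::'a) * conjugate 1 = conjugate 1" by (simp flip: conjugate_dist_mul)
    then have "conjugate (1::'a) = 1"
      by (metis conjugate_zero_iff mult_cancel_left2 zero_neq_one)
    then have "0 \<le> - c - c" using nonneg[of 1 1] True by simp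
    then have "0 \<le> - c" using add_mono[OF _ c0, of 0 "- c - c"] by simp
    then have "c \<le> 0" using add_mono[OF _ order_refl[of c], of 0 "- c"] by simp
    with c0 show ?thesis by simp
  next
    case False
    have "0 \<le> - (c * c * r)" using nonneg[of r c] cc rr by (simp add: algebra_simps)
    \<comment> \<open>the form at \<open>- c z\<close>\<close>
    moreover have "0 \<le> c * c * r" using nonneg[of 0 c] cc by simp
    ultimately have "c * c * r = 0"
      by (metis add.right_inverse add_nonneg_eq_0_iff)
    with False show ?thesis by simp
  qed
  then show ?thesis using conjugate_square_eq_0_vec[OF z] by (simp add: c_def z_def)
qed

section \<open>The optimality pencil\<close>

text \<open>
The real and the complex numbers are both instances of the class of scalars used here, so one
argument serves the two cases.
\<close>
locale optimality_pencil =
  fixes n m :: nat and J R Q B :: "'a::conjugatable_ordered_field mat"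
  assumes sys: "(J, R, Q, B) \<in> Sigma_sys n m"
begin

abbreviation "\<E> \<equiv> opt_E n m :: 'a mat"
abbreviation "\<A> \<equiv> opt_A n m J R Q B (0\<^sub>m m m)"
abbreviation "F \<equiv> (J - R) * Q"
abbreviation "W \<equiv> Q * R * Q"

lemma carriers:
  "J \<in> carrier_mat n n" "R \<in> carrier_mat n n" "Q \<in> carrier_mat n n" "B \<in> carrier_mat n m"
  "F \<in> carrier_mat n n" "W \<in> carrier_mat n n"
  using sys by (auto simp: Sigma_sys_def)

lemma opt_E_carrier: "\<E> \<in> carrier_mat (n + n + m) (n + n + m)"
  by (auto simp: opt_E_def nine_block_mat_def)

lemma opt_A_carrier: "\<A> \<in> carrier_mat (n + n + m) (n + n + m)"
  using carriers by (auto simp: opt_A_def nine_block_mat_def)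

lemma opt_E_mult_vec:
  assumes "x \<in> carrier_vec n" "y \<in> carrier_vec n" "u \<in> carrier_vec m"
  shows "\<E> *\<^sub>v ((x @\<^sub>v y) @\<^sub>v u) = (y @\<^sub>v - x) @\<^sub>v 0\<^sub>v m"
proof -
  have "- 1\<^sub>m n *\<^sub>v x = - x" using assms by (intro eq_vecI) auto
  then show ?thesis unfolding opt_E_def
    using assms by (subst nine_block_mult_vec[of _ n n _ n _ m _ n _ _ _ m]) auto
qed

lemma opt_A_mult_vec:
  assumes "x \<in> carrier_vec n" "y \<in> carrier_vec n" "u \<in> carrier_vec m"
  shows "\<A> *\<^sub>v ((x @\<^sub>v y) @\<^sub>v u) =
    ((F *\<^sub>v y + B *\<^sub>v u) @\<^sub>v (mat_adjoint F *\<^sub>v x + W *\<^sub>v y)) @\<^sub>v (mat_adjoint B *\<^sub>v x)"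
proof -
  note c = carriers mat_adjoint_carrier[OF carriers(4)] mat_adjoint_carrier[OF carriers(5)]
  have cv: "F *\<^sub>v y \<in> carrier_vec n" "W *\<^sub>v y \<in> carrier_vec n" "B *\<^sub>v u \<in> carrier_vec n"
    "mat_adjoint F *\<^sub>v x \<in> carrier_vec n" "mat_adjoint B *\<^sub>v x \<in> carrier_vec m"
    using c assms by (blast intro: mult_mat_vec_carrier)+
  have z: "0\<^sub>m a b *\<^sub>v v = 0\<^sub>v a" if "v \<in> carrier_vec b" for a b and v :: "'a vec"
    using that by auto
  show ?thesis unfolding opt_A_def
    nine_block_mult_vec[OF zero_carrier_mat c(5,4) c(8,6) zero_carrier_mat c(7) zero_carrier_mat zero_carrier_mat assms]
    using cv assms by (simp add: z)
qed

text \<open>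
One step of a chain.  The first two block equations determine the new \<open>y\<close> and \<open>x\<close>; the third one
constrains the old \<open>x\<close>, and it is the only obstruction to prolonging a chain.
\<close>
lemma opt_chain_step_iff:
  assumes "x \<in> carrier_vec n" "y \<in> carrier_vec n" "u \<in> carrier_vec m"
    and "x' \<in> carrier_vec n" "y' \<in> carrier_vec n" "u' \<in> carrier_vec m"
  shows "\<E> *\<^sub>v ((x' @\<^sub>v y') @\<^sub>v u') = \<A> *\<^sub>v ((x @\<^sub>v y) @\<^sub>v u) \<longleftrightarrow>
    y' = F *\<^sub>v y + B *\<^sub>v u \<and> - x' = mat_adjoint F *\<^sub>v x + W *\<^sub>v y \<and> mat_adjoint B *\<^sub>v x = 0\<^sub>v m"
proof -
  have "F *\<^sub>v y + B *\<^sub>v u \<in> carrier_vec n" "mat_adjoint F *\<^sub>v x + W *\<^sub>v y \<in> carrier_vec n"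
    using carriers assms mat_adjoint_carrier[OF carriers(5)]
    by (blast intro: mult_mat_vec_carrier add_carrier_vec)+
  then show ?thesis unfolding opt_E_mult_vec[OF assms(4-6)] opt_A_mult_vec[OF assms(1-3)]
    using assms by (subst triple_vec_eq_iff[of _ n]) auto
qed

text \<open>
Start from \<open>(0, 0, v)\<close> and take the last component to be zero from then on.  The sequence of states is
forced: its first components are \<open>0\<close>, \<open>0\<close>, \<open>- W B v\<close>, so the constraint \<open>B\<^sup>H x = 0\<close> of a step is met
automatically by the first two states, and by the third one exactly under the hypothesis.
\<close>
lemma opt_chain_exists:
  assumes v: "v \<in> carrier_vec m" "v \<noteq> 0\<^sub>v m"
    and k: "k \<le> 2 \<or> k = 3 \<and> mat_adjoint B *\<^sub>v (W *\<^sub>v (B *\<^sub>v v)) = 0\<^sub>v m"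
  shows "\<exists>z. chain_at_infinity \<E> \<A> k z"
proof -
  note BH = mat_adjoint_carrier[OF carriers(4)] and FH = mat_adjoint_carrier[OF carriers(5)]
  note [intro] = mult_mat_vec_carrier
  have o: "(0\<^sub>v n :: 'a vec) \<in> carrier_vec n" "(0\<^sub>v m :: 'a vec) \<in> carrier_vec m" by auto
  define y1 where "y1 = B *\<^sub>v v"
  define y2 where "y2 = F *\<^sub>v y1"
  define x2 where "x2 = - (W *\<^sub>v y1)"
  define y3 where "y3 = F *\<^sub>v y2"
  define x3 where "x3 = - (mat_adjoint F *\<^sub>v x2 + W *\<^sub>v y2)"
  have y1: "y1 \<in> carrier_vec n" unfolding y1_def using carriers v by blast
  have Wy1: "W *\<^sub>v y1 \<in> carrier_vec n" using carriers y1 by blast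
  have y2: "y2 \<in> carrier_vec n" unfolding y2_def using carriers y1 by blast
  have x2: "x2 \<in> carrier_vec n" unfolding x2_def using Wy1 by simp
  have y3: "y3 \<in> carrier_vec n" unfolding y3_def using carriers y2 by blast
  have FW: "mat_adjoint F *\<^sub>v x2 \<in> carrier_vec n" "W *\<^sub>v y2 \<in> carrier_vec n" using FH x2 carriers y2 by blast+
  have x3: "x3 \<in> carrier_vec n" unfolding x3_def using FW by simp
  define z where "z i = (if i = 0 then (0\<^sub>v n @\<^sub>v 0\<^sub>v n) @\<^sub>v v else if i = 1 then (0\<^sub>v n @\<^sub>v y1) @\<^sub>v 0\<^sub>v m
    else if i = 2 then (x2 @\<^sub>v y2) @\<^sub>v 0\<^sub>v m else (x3 @\<^sub>v y3) @\<^sub>v 0\<^sub>v m)" for i :: nat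
  have Fy2: "F *\<^sub>v y1 \<in> carrier_vec n" "F *\<^sub>v y2 \<in> carrier_vec n" using y2 y3 by (simp_all add: y2_def y3_def)
  have s0: "\<E> *\<^sub>v z 1 = \<A> *\<^sub>v z 0"
    using opt_chain_step_iff[OF o(1) o(1) v(1) o(1) y1 o(2)] y1 mult_mat_zero_vec[OF carriers(5)] mult_mat_zero_vec[OF carriers(6)]
      mult_mat_zero_vec[OF FH] mult_mat_zero_vec[OF BH] by (simp add: z_def y1_def)
  have s1: "\<E> *\<^sub>v z 2 = \<A> *\<^sub>v z 1"
    using opt_chain_step_iff[OF o(1) y1 o(2) x2 y2 o(2)] Wy1 mult_mat_zero_vec[OF carriers(4)]
      mult_mat_zero_vec[OF FH] mult_mat_zero_vec[OF BH] Fy2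
    by (simp add: z_def x2_def y2_def)
  have s2: "\<E> *\<^sub>v z 3 = \<A> *\<^sub>v z 2" if "mat_adjoint B *\<^sub>v (W *\<^sub>v (B *\<^sub>v v)) = 0\<^sub>v m"
  proof -
    have "mat_adjoint B *\<^sub>v x2 = - (mat_adjoint B *\<^sub>v (W *\<^sub>v y1))"
      unfolding x2_def by (rule mult_mat_vec_uminus[OF BH Wy1])
    then have "mat_adjoint B *\<^sub>v x2 = 0\<^sub>v m" using that by (simp add: y1_def)
    then show ?thesis
      using opt_chain_step_iff[OF x2 y2 o(2) x3 y3 o(2)] mult_mat_zero_vec[OF carriers(4)] FW Fy2
      by (simp add: z_def x3_def y3_def)
  qed
  have step: "\<E> *\<^sub>v z (Suc i) = \<A> *\<^sub>v z i" if ik: "i < k" for i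
  proof -
    consider "i = 0" | "i = 1" | "i = 2" "k = 3" using k ik by force
    then show ?thesis using s0 s1 s2 k by cases (auto simp: numeral_eq_Suc)
  qed
  have dim: "dim_row \<E> = n + n + m" "dim_col \<E> = n + n + m" using opt_E_carrier by auto
  have zero: "0\<^sub>v (n + n + m) = (0\<^sub>v n @\<^sub>v 0\<^sub>v n) @\<^sub>v (0\<^sub>v m :: 'a vec)" by (intro eq_vecI) auto
  have "z 0 \<noteq> 0\<^sub>v (n + n + m)" unfolding zero z_def using v triple_vec_eq_iff[OF o(1) o(1) o(1) o(1), of v] by simp
  moreover have "\<E> *\<^sub>v z 0 = 0\<^sub>v (n + n + m)"
    unfolding zero z_def using opt_E_mult_vec[OF o(1) o(1) v(1)] by simp
  moreover have "z i \<in> carrier_vec (n + n + m)" for i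
    using v y1 x2 y2 x3 y3 by (auto simp: z_def)
  ultimately have "chain_at_infinity \<E> \<A> k z"
    using step by (simp add: chain_at_infinity_def dim)
  then show ?thesis by blast
qed

text \<open>
The kernel of the matrix that multiplies \<open>s\<close> consists of the vectors \<open>(0, 0, u)\<close>.  Following the steps
from such a vector gives \<open>x = - W B u\<close> after two steps, irrespective of the third components chosen
later, and the third step requires \<open>B\<^sup>H x = 0\<close>.
\<close>
lemma opt_chain_of_length_four:
  assumes chain: "chain_at_infinity \<E> \<A> 3 z"
  shows "\<exists>v \<in> carrier_vec m. v \<noteq> 0\<^sub>v m \<and> mat_adjoint B *\<^sub>v (W *\<^sub>v (B *\<^sub>v v)) = 0\<^sub>v m"
proof -
  note BH = mat_adjoint_carrier[OF carriers(4)] and FH = mat_adjoint_carrier[OF carriers(5)]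
  have dim: "dim_row \<E> = n + n + m" "dim_col \<E> = n + n + m" using opt_E_carrier by auto
  have zero: "0\<^sub>v (n + n + m) = (0\<^sub>v n @\<^sub>v 0\<^sub>v n) @\<^sub>v (0\<^sub>v m :: 'a vec)" by (intro eq_vecI) auto
  define x where "x i = vec_first (vec_first (z i) (n + n)) n" for i
  define y where "y i = vec_last (vec_first (z i) (n + n)) n" for i
  define u where "u i = vec_last (z i) m" for i
  have x: "x i \<in> carrier_vec n" and y: "y i \<in> carrier_vec n" and u: "u i \<in> carrier_vec m" for i
    by (auto simp: x_def y_def u_def)
  have z: "z i = (x i @\<^sub>v y i) @\<^sub>v u i" for i
  proof -
    have "z i \<in> carrier_vec (n + n + m)" using chain dim by (simp add: chain_at_infinity_def)
    then show ?thesis by (simp add: x_def y_def u_def)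
  qed
  have step: "y (Suc i) = F *\<^sub>v y i + B *\<^sub>v u i" "- x (Suc i) = mat_adjoint F *\<^sub>v x i + W *\<^sub>v y i"
    "mat_adjoint B *\<^sub>v x i = 0\<^sub>v m" if "i < 3" for i
    using chain that opt_chain_step_iff[OF x[of i] y[of i] u[of i] x[of "Suc i"] y[of "Suc i"] u[of "Suc i"]]
    by (simp_all add: chain_at_infinity_def z)
  have "(y 0 @\<^sub>v - x 0) @\<^sub>v 0\<^sub>v m = (0\<^sub>v n @\<^sub>v 0\<^sub>v n) @\<^sub>v (0\<^sub>v m :: 'a vec)"
    using chain opt_E_mult_vec[OF x y u, of 0 0 0] by (simp add: chain_at_infinity_def z dim zero)
  then have "y 0 = 0\<^sub>v n" "- x 0 = 0\<^sub>v n"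
    using triple_vec_eq_iff[of "y 0" n "0\<^sub>v n" "- x 0" "0\<^sub>v n" "0\<^sub>v m" "0\<^sub>v m"] x y by auto
  then have xy0: "x 0 = 0\<^sub>v n" "y 0 = 0\<^sub>v n" using uminus_uminus_vec[of "x 0"] by auto
  have "u 0 \<noteq> 0\<^sub>v m" using chain xy0 by (auto simp: chain_at_infinity_def z dim zero)
  moreover have y1: "y 1 = B *\<^sub>v u 0"
    using step(1)[of 0] xy0 mult_mat_zero_vec[OF carriers(5)] mult_mat_vec_carrier[OF carriers(4) u] by simp
  have "- x 1 = 0\<^sub>v n"
    using step(2)[of 0] xy0 mult_mat_zero_vec[OF FH] mult_mat_zero_vec[OF carriers(6)] by simp
  then have x1: "x 1 = 0\<^sub>v n" using uminus_uminus_vec[of "x 1"] by auto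
  have "- x 2 = W *\<^sub>v (B *\<^sub>v u 0)"
    using step(2)[of 1] x1 y1 mult_mat_zero_vec[OF FH] mult_mat_vec_carrier[OF carriers(6) y[of 1]]
    by (simp add: numeral_2_eq_2)
  moreover have "mat_adjoint B *\<^sub>v (- x 2) = - (mat_adjoint B *\<^sub>v x 2)"
    by (rule mult_mat_vec_uminus[OF BH x])
  moreover have "mat_adjoint B *\<^sub>v x 2 = 0\<^sub>v m" using step(3)[of 2] by simp
  ultimately show ?thesis using u by auto
qed

text \<open>
Pairing with \<open>v\<close> gives \<open>q\<^sup>H R q = 0\<close> for \<open>q = Q B v\<close>, and a positive semidefinite form vanishes only on
the kernel of its matrix.
\<close>
lemma gram_kernel_iff:
  assumes v: "v \<in> carrier_vec m"
  shows "mat_adjoint B *\<^sub>v (W *\<^sub>v (B *\<^sub>v v)) = 0\<^sub>v m \<longleftrightarrow> (R * Q) *\<^sub>v (B *\<^sub>v v) = 0\<^sub>v n"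
proof -
  have herm: "R = mat_adjoint R" "Q = mat_adjoint Q" and psd: "psd_mat n R"
    using sys by (auto simp: Sigma_sys_def)
  define y where "y = B *\<^sub>v v"
  define q where "q = Q *\<^sub>v y"
  have y: "y \<in> carrier_vec n" unfolding y_def using mult_mat_vec_carrier[OF carriers(4) v] .
  have q: "q \<in> carrier_vec n" unfolding q_def using mult_mat_vec_carrier[OF carriers(3) y] .
  have Rq: "R *\<^sub>v q \<in> carrier_vec n" using mult_mat_vec_carrier[OF carriers(2) q] .
  have RQ: "(R * Q) *\<^sub>v y = R *\<^sub>v q"
    unfolding q_def by (rule assoc_mult_mat_vec[OF carriers(2,3) y])
  have W: "W *\<^sub>v y = Q *\<^sub>v (R *\<^sub>v q)"
    using assoc_mult_mat_vec[OF mult_carrier_mat[OF carriers(3,2)] carriers(3) y]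
      assoc_mult_mat_vec[OF carriers(3,2) q] by (simp add: q_def)
  have "mat_adjoint B *\<^sub>v (W *\<^sub>v y) = 0\<^sub>v m \<longleftrightarrow> R *\<^sub>v q = 0\<^sub>v n"
  proof
    assume 0: "mat_adjoint B *\<^sub>v (W *\<^sub>v y) = 0\<^sub>v m"
    have "conjugate q \<bullet> (R *\<^sub>v q) = conjugate y \<bullet> (Q *\<^sub>v (R *\<^sub>v q))"
      using scalar_prod_mat_adjoint[OF carriers(3) y Rq] herm(2) by (simp add: q_def)
    also have "\<dots> = conjugate v \<bullet> (mat_adjoint B *\<^sub>v (W *\<^sub>v y))"
      using scalar_prod_mat_adjoint[OF carriers(4) v mult_mat_vec_carrier[OF carriers(6) y]]
      by (simp add: y_def flip: W)
    also have "\<dots> = 0" using 0 v by simp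
    finally show "R *\<^sub>v q = 0\<^sub>v n" by (rule psd_form_zero_imp_kernel[OF carriers(2) herm(1) psd q])
  next
    assume "R *\<^sub>v q = 0\<^sub>v n"
    then show "mat_adjoint B *\<^sub>v (W *\<^sub>v y) = 0\<^sub>v m"
      using W mult_mat_zero_vec[OF carriers(3)] mult_mat_zero_vec[OF mat_adjoint_carrier[OF carriers(4)]] by simp
  qed
  then show ?thesis by (simp add: y_def[symmetric] RQ)
qed

lemma image_kernel_iff:
  "im_mat B \<inter> mat_kernel (R * Q) = {0\<^sub>v n} \<and> mat_kernel B = {0\<^sub>v m} \<longleftrightarrow>
   \<not> (\<exists>v \<in> carrier_vec m. v \<noteq> 0\<^sub>v m \<and> (R * Q) *\<^sub>v (B *\<^sub>v v) = 0\<^sub>v n)"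
proof -
  have RQ: "R * Q \<in> carrier_mat n n" using carriers by auto
  have im: "im_mat B = {B *\<^sub>v v | v. v \<in> carrier_vec m}" using carriers(4) by (auto simp: im_mat_def)
  have kRQ: "mat_kernel (R * Q) = {w \<in> carrier_vec n. (R * Q) *\<^sub>v w = 0\<^sub>v n}"
    and kB: "mat_kernel B = {v \<in> carrier_vec m. B *\<^sub>v v = 0\<^sub>v n}"
    using mat_kernel[OF RQ] mat_kernel[OF carriers(4)] by auto
  have Bv: "B *\<^sub>v v \<in> carrier_vec n" if "v \<in> carrier_vec m" for v
    using mult_mat_vec_carrier[OF carriers(4) that] .
  have B0: "B *\<^sub>v 0\<^sub>v m = 0\<^sub>v n" "(R * Q) *\<^sub>v 0\<^sub>v n = 0\<^sub>v n" using mult_mat_zero_vec[OF carriers(4)] mult_mat_zero_vec[OF RQ] by auto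
  show ?thesis
  proof
    assume h: "im_mat B \<inter> mat_kernel (R * Q) = {0\<^sub>v n} \<and> mat_kernel B = {0\<^sub>v m}"
    have "v = 0\<^sub>v m" if v: "v \<in> carrier_vec m" "(R * Q) *\<^sub>v (B *\<^sub>v v) = 0\<^sub>v n" for v
    proof -
      have "B *\<^sub>v v \<in> im_mat B \<inter> mat_kernel (R * Q)" using v Bv unfolding im kRQ by blast
      with h have "v \<in> mat_kernel B" using v unfolding kB by auto
      with h show ?thesis by blast
    qed
    then show "\<not> (\<exists>v \<in> carrier_vec m. v \<noteq> 0\<^sub>v m \<and> (R * Q) *\<^sub>v (B *\<^sub>v v) = 0\<^sub>v n)" by blast
  next
    assume h: "\<not> (\<exists>v \<in> carrier_vec m. v \<noteq> 0\<^sub>v m \<and> (R * Q) *\<^sub>v (B *\<^sub>v v) = 0\<^sub>v n)"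
    have "mat_kernel B \<subseteq> {0\<^sub>v m}" using h B0 unfolding kB by auto
    moreover have "im_mat B \<inter> mat_kernel (R * Q) \<subseteq> {0\<^sub>v n}"
      using h B0 unfolding im kRQ by auto
    moreover have "0\<^sub>v m \<in> mat_kernel B" using B0 unfolding kB by simp
    moreover have "0\<^sub>v n \<in> im_mat B \<inter> mat_kernel (R * Q)"
      using B0 unfolding im kRQ by (metis (mono_tags, lifting) IntI mem_Collect_eq zero_carrier_vec)
    ultimately show "im_mat B \<inter> mat_kernel (R * Q) = {0\<^sub>v n} \<and> mat_kernel B = {0\<^sub>v m}" by blast
  qed
qed

theorem index_three_iff:
  assumes "0 < m"
  shows "(im_mat B \<inter> mat_kernel (R * Q) = {0\<^sub>v n} \<and> mat_kernel B = {0\<^sub>v m}) \<longleftrightarrow>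
    (regular_pencil \<E> \<A> \<and> has_kronecker_index \<E> \<A> 3)"
proof -
  have "\<exists>z. chain_at_infinity \<E> \<A> 2 z"
    using opt_chain_exists[of "unit_vec m 0" 2] assms by auto
  moreover have "(\<exists>z. chain_at_infinity \<E> \<A> 3 z) \<longleftrightarrow>
      (\<exists>v \<in> carrier_vec m. v \<noteq> 0\<^sub>v m \<and> mat_adjoint B *\<^sub>v (W *\<^sub>v (B *\<^sub>v v)) = 0\<^sub>v m)"
    using opt_chain_exists[of _ 3] opt_chain_of_length_four by blast
  ultimately show ?thesis
    using kronecker_index_iff_chains[OF opt_E_carrier opt_A_carrier, of 2]
    unfolding image_kernel_iff using gram_kernel_iff by (simp add: numeral_3_eq_3)
qed

end

theorem proposition3p9:
  fixes n m :: nat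
  assumes "0 < n" and "0 < m"
  shows
    "(\<forall>(J :: real mat) R Q B. (J, R, Q, B) \<in> Sigma_sys n m \<longrightarrow>
        ((im_mat B \<inter> mat_kernel (R * Q) = {0\<^sub>v n} \<and> mat_kernel B = {0\<^sub>v m}) \<longleftrightarrow>
         (regular_pencil (opt_E n m) (opt_A n m J R Q B (0\<^sub>m m m)) \<and>
          has_kronecker_index (opt_E n m) (opt_A n m J R Q B (0\<^sub>m m m)) 3))) \<and>
     (\<forall>(J :: complex mat) R Q B. (J, R, Q, B) \<in> Sigma_sys n m \<longrightarrow>
        ((im_mat B \<inter> mat_kernel (R * Q) = {0\<^sub>v n} \<and> mat_kernel B = {0\<^sub>v m}) \<longleftrightarrow>
         (regular_pencil (opt_E n m) (opt_A n m J R Q B (0\<^sub>m m m)) \<and>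
          has_kronecker_index (opt_E n m) (opt_A n m J R Q B (0\<^sub>m m m)) 3)))"
proof (intro conjI allI impI)
  fix J R Q B :: "real mat"
  assume "(J, R, Q, B) \<in> Sigma_sys n m"
  then interpret optimality_pencil n m J R Q B by unfold_locales
  show "(im_mat B \<inter> mat_kernel (R * Q) = {0\<^sub>v n} \<and> mat_kernel B = {0\<^sub>v m}) \<longleftrightarrow>
    (regular_pencil (opt_E n m) (opt_A n m J R Q B (0\<^sub>m m m)) \<and>
     has_kronecker_index (opt_E n m) (opt_A n m J R Q B (0\<^sub>m m m)) 3)"
    by (rule index_three_iff[OF assms(2)])
next
  fix J R Q B :: "complex mat"
  assume "(J, R, Q, B) \<in> Sigma_sys n m"
  then interpret optimality_pencil n m J R Q B by unfold_locales
  show "(im_mat B \<inter> mat_kernel (R * Q) = {0\<^sub>v n} \<and> mat_kernel B = {0\<^sub>v m}) \<longleftrightarrow>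
    (regular_pencil (opt_E n m) (opt_A n m J R Q B (0\<^sub>m m m)) \<and>
     has_kronecker_index (opt_E n m) (opt_A n m J R Q B (0\<^sub>m m m)) 3)"
    by (rule index_three_iff[OF assms(2)])
qed

end
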